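(* Let $R$ be a ring and $M$ a right $R$-module such that $\operatorname{End}_R(M)$ has no factor ring isomorphic to $\mathbb{F}_2$. Then $M$ is quasi-injective if and only if $M$ is automorphism-invariant.
   Context: All rings are associative with identity; modules are unital right modules. $\mathbb{F}_2$ is the field with two elements. A ring $T$ "has a factor isomorphic to $\mathbb{F}_2$" if there is a two-sided ideal $I$ of $T$ with $T/I\cong \mathbb{F}_2$, equivalently if there exists a unital ring homomorphism $T\to\mathbb{F}_2$. $E(M)$ denotes the injective hull of $M$. A module $M$ is quasi-injective if every homomorphism from a submodule $L$ of $M$ to $M$ extends to an endomorphism of $M$ (equivalently, $\varphi(M)\subseteq M$ for every endomorphism $\varphi$ of $E(M)$). A module $M$ is automorphism-invariant if $\sigma(M)\subseteq M$ for every automorphism $\sigma$ of $E(M)$. *)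

theory Defs
  imports "HOL-Algebra.Ring"
begin

record ('r, 'm) rmodule =
  mcarrier :: "'m set"
  madd :: "'m \<Rightarrow> 'm \<Rightarrow> 'm"
  mzero :: 'm
  mact :: "'m \<Rightarrow> 'r \<Rightarrow> 'm"

definition right_module :: "('r, 'a) ring_scheme \<Rightarrow> ('r, 'm, 'b) rmodule_scheme \<Rightarrow> bool" where
  "right_module R M \<longleftrightarrow> ring R \<and>
     mzero M \<in> mcarrier M \<and>
     (\<forall>x\<in>mcarrier M. \<forall>y\<in>mcarrier M. madd M x y \<in> mcarrier M) \<and>
     (\<forall>x\<in>mcarrier M. \<forall>y\<in>mcarrier M. \<forall>z\<in>mcarrier M.
        madd M (madd M x y) z = madd M x (madd M y z)) \<and>
     (\<forall>x\<in>mcarrier M. \<forall>y\<in>mcarrier M. madd M x y = madd M y x) \<and>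
     (\<forall>x\<in>mcarrier M. madd M (mzero M) x = x) \<and>
     (\<forall>x\<in>mcarrier M. \<exists>y\<in>mcarrier M. madd M x y = mzero M) \<and>
     (\<forall>x\<in>mcarrier M. \<forall>r\<in>carrier R. mact M x r \<in> mcarrier M) \<and>
     (\<forall>x\<in>mcarrier M. \<forall>y\<in>mcarrier M. \<forall>r\<in>carrier R.
        mact M (madd M x y) r = madd M (mact M x r) (mact M y r)) \<and>
     (\<forall>x\<in>mcarrier M. \<forall>r\<in>carrier R. \<forall>s\<in>carrier R.
        mact M x (r \<oplus>\<^bsub>R\<^esub> s) = madd M (mact M x r) (mact M x s)) \<and>
     (\<forall>x\<in>mcarrier M. \<forall>r\<in>carrier R. \<forall>s\<in>carrier R.
        mact M x (r \<otimes>\<^bsub>R\<^esub> s) = mact M (mact M x r) s) \<and>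
     (\<forall>x\<in>mcarrier M. mact M x \<one>\<^bsub>R\<^esub> = x)"

definition rhom :: "('r, 'a) ring_scheme \<Rightarrow> ('r, 'm, 'b) rmodule_scheme \<Rightarrow> ('r, 'n, 'c) rmodule_scheme
    \<Rightarrow> ('m \<Rightarrow> 'n) \<Rightarrow> bool" where
  "rhom R M N f \<longleftrightarrow>
     (\<forall>x\<in>mcarrier M. f x \<in> mcarrier N) \<and>
     (\<forall>x\<in>mcarrier M. \<forall>y\<in>mcarrier M. f (madd M x y) = madd N (f x) (f y)) \<and>
     (\<forall>x\<in>mcarrier M. \<forall>r\<in>carrier R. f (mact M x r) = mact N (f x) r)"

definition submodule :: "('r, 'a) ring_scheme \<Rightarrow> ('r, 'm, 'b) rmodule_scheme \<Rightarrow> 'm set \<Rightarrow> bool" where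
  "submodule R M L \<longleftrightarrow> L \<subseteq> mcarrier M \<and> mzero M \<in> L \<and>
     (\<forall>x\<in>L. \<forall>y\<in>L. madd M x y \<in> L) \<and>
     (\<forall>x\<in>L. \<forall>r\<in>carrier R. mact M x r \<in> L)"

definition quasi_injective :: "('r, 'a) ring_scheme \<Rightarrow> ('r, 'm, 'b) rmodule_scheme \<Rightarrow> bool" where
  "quasi_injective R M \<longleftrightarrow>
     (\<forall>L f. submodule R M L \<and> rhom R (M\<lparr>mcarrier := L\<rparr>) M f \<longrightarrow>
        (\<exists>g. rhom R M M g \<and> (\<forall>x\<in>L. g x = f x)))"

definition right_ideal :: "('r, 'a) ring_scheme \<Rightarrow> 'r set \<Rightarrow> bool" where
  "right_ideal R I \<longleftrightarrow> I \<subseteq> carrier R \<and> \<zero>\<^bsub>R\<^esub> \<in> I \<and>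
     (\<forall>a\<in>I. \<forall>b\<in>I. a \<oplus>\<^bsub>R\<^esub> b \<in> I) \<and>
     (\<forall>a\<in>I. \<forall>r\<in>carrier R. a \<otimes>\<^bsub>R\<^esub> r \<in> I)"

text \<open>Injective module, via Baer's criterion: every R-linear map from a right ideal I of R
  into E is given by left multiplication by an element of E (i.e. extends to R_R).\<close>
definition injective_module :: "('r, 'a) ring_scheme \<Rightarrow> ('r, 'm, 'b) rmodule_scheme \<Rightarrow> bool" where
  "injective_module R E \<longleftrightarrow>
     (\<forall>I h. right_ideal R I \<and>
        (\<forall>a\<in>I. h a \<in> mcarrier E) \<and>
        (\<forall>a\<in>I. \<forall>b\<in>I. h (a \<oplus>\<^bsub>R\<^esub> b) = madd E (h a) (h b)) \<and>
        (\<forall>a\<in>I. \<forall>r\<in>carrier R. h (a \<otimes>\<^bsub>R\<^esub> r) = mact E (h a) r)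
      \<longrightarrow> (\<exists>e\<in>mcarrier E. \<forall>a\<in>I. h a = mact E e a))"

definition essential_submodule :: "('r, 'a) ring_scheme \<Rightarrow> ('r, 'm, 'b) rmodule_scheme \<Rightarrow> 'm set \<Rightarrow> bool" where
  "essential_submodule R E N \<longleftrightarrow> submodule R E N \<and>
     (\<forall>L. submodule R E L \<and> L \<noteq> {mzero E} \<longrightarrow> L \<inter> N \<noteq> {mzero E})"

definition injective_hull :: "('r, 'a) ring_scheme \<Rightarrow> ('r, 'm, 'b) rmodule_scheme
    \<Rightarrow> ('r, 'e, 'c) rmodule_scheme \<Rightarrow> ('m \<Rightarrow> 'e) \<Rightarrow> bool" where
  "injective_hull R M E \<iota> \<longleftrightarrow> right_module R E \<and> rhom R M E \<iota> \<and> inj_on \<iota> (mcarrier M) \<and>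
     injective_module R E \<and> essential_submodule R E (\<iota> ` mcarrier M)"

definition rautomorphism :: "('r, 'a) ring_scheme \<Rightarrow> ('r, 'e, 'c) rmodule_scheme \<Rightarrow> ('e \<Rightarrow> 'e) \<Rightarrow> bool" where
  "rautomorphism R E \<sigma> \<longleftrightarrow> rhom R E E \<sigma> \<and> bij_betw \<sigma> (mcarrier E) (mcarrier E)"

text \<open>Automorphism-invariant, relative to a given injective hull (E, \<iota>) of M:
  \<sigma>(M) \<subseteq> M for every automorphism \<sigma> of E.\<close>
definition automorphism_invariant :: "('r, 'a) ring_scheme \<Rightarrow> ('r, 'm, 'b) rmodule_scheme
    \<Rightarrow> ('r, 'e, 'c) rmodule_scheme \<Rightarrow> ('m \<Rightarrow> 'e) \<Rightarrow> bool" where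
  "automorphism_invariant R M E \<iota> \<longleftrightarrow>
     (\<forall>\<sigma>. rautomorphism R E \<sigma> \<longrightarrow> \<sigma> ` (\<iota> ` mcarrier M) \<subseteq> \<iota> ` mcarrier M)"

text \<open>End_R(M) has a factor ring isomorphic to F_2, i.e. there is a unital ring homomorphism
  End_R(M) \<rightarrow> F_2.  F_2 is modelled by bool (addition = xor, multiplication = and).
  Endomorphisms are identified when they agree on the carrier; the product is composition.\<close>
definition End_has_F2_factor :: "('r, 'a) ring_scheme \<Rightarrow> ('r, 'm, 'b) rmodule_scheme \<Rightarrow> bool" where
  "End_has_F2_factor R M \<longleftrightarrow>
     (\<exists>\<phi> :: ('m \<Rightarrow> 'm) \<Rightarrow> bool.
        (\<forall>g h. rhom R M M g \<and> rhom R M M h \<and> (\<forall>x\<in>mcarrier M. g x = h x) \<longrightarrow> \<phi> g = \<phi> h) \<and>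
        \<phi> id \<and>
        (\<forall>g h. rhom R M M g \<and> rhom R M M h \<longrightarrow>
            \<phi> (\<lambda>x. madd M (g x) (h x)) = (\<phi> g \<noteq> \<phi> h)) \<and>
        (\<forall>g h. rhom R M M g \<and> rhom R M M h \<longrightarrow> \<phi> (g \<circ> h) = (\<phi> g \<and> \<phi> h)))"

end

theory Submission
  imports Defs "HOL-Algebra.QuotRing"
begin

text \<open>
  Let \<open>S = End(E)\<close>, let \<open>N\<close> be the image of \<open>M\<close> in \<open>E\<close>, and let \<open>T\<close> be the subring of those
  \<open>s \<in> S\<close> with \<open>s(N) \<subseteq> N\<close>. Quasi-injectivity means \<open>T = S\<close>, automorphism-invariance means that \<open>T\<close>
  contains the units of \<open>S\<close>. Let \<open>I\<close> be the largest ideal of \<open>S\<close> contained in \<open>T\<close>. Since \<open>1 + n\<close> is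
  a unit whenever \<open>n\<^sup>2 = 0\<close>, all \<open>e s (1 - e)\<close> with \<open>e\<close> idempotent lie in \<open>I\<close>, so idempotents become
  central in \<open>S/I\<close>. Injectivity of \<open>E\<close> yields that every \<open>x \<in> S\<close> is congruent modulo \<open>I\<close> to
  \<open>u f\<close> with \<open>u\<close> a unit and \<open>f\<close> an idempotent of \<open>S\<close>.

  If \<open>T \<noteq> S\<close>, take a maximal ideal \<open>P\<close> of \<open>S/I\<close>. Every element outside \<open>P\<close> is congruent to a unit
  modulo \<open>P\<close>. If some \<open>a\<close> had \<open>a, 1 - a \<notin> P\<close>, write \<open>a = u f\<close> and \<open>1 - a = v g\<close>; for every
  idempotent \<open>d\<close> below \<open>e = f g\<close> the units \<open>u d + (1 - d)\<close> and \<open>v d - (1 - d)\<close> add up to \<open>d\<close>,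
  which puts the ideal generated by \<open>e\<close> into \<open>T/I\<close> although \<open>e \<notin> P\<close>. Hence the residue ring at \<open>P\<close>
  is the field with two elements. The resulting homomorphism on \<open>S\<close> kills endomorphisms with
  essential kernel, so it descends to \<open>End(M)\<close> by extending endomorphisms of \<open>M\<close> to \<open>E\<close>.
\<close>

section \<open>Rings whose idempotents are central modulo an ideal\<close>

text \<open>The field F_2 is again modelled by \<open>bool\<close> with exclusive or and
  conjunction, to match \<open>End_has_F2_factor\<close>. Only values on the carrier are
  constrained; additivity at zero forces the value \<open>False\<close> there.\<close>

definition F2_hom :: "('a, 'b) ring_scheme \<Rightarrow> ('a \<Rightarrow> bool) \<Rightarrow> bool" where
  "F2_hom R \<phi> \<longleftrightarrow> \<phi> \<one>\<^bsub>R\<^esub> \<and>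
     (\<forall>x\<in>carrier R. \<forall>y\<in>carrier R. \<phi> (x \<oplus>\<^bsub>R\<^esub> y) = (\<phi> x \<noteq> \<phi> y)) \<and>
     (\<forall>x\<in>carrier R. \<forall>y\<in>carrier R. \<phi> (x \<otimes>\<^bsub>R\<^esub> y) = (\<phi> x \<and> \<phi> y))"

context ring
begin

text \<open>Negatives are multiples by minus one, so sums and two-sided multiples suffice.\<close>

lemma idealI_closed:
  assumes "I \<subseteq> carrier R" "\<zero> \<in> I"
    and "\<And>a b. a \<in> I \<Longrightarrow> b \<in> I \<Longrightarrow> a \<oplus> b \<in> I"
    and "\<And>a x. a \<in> I \<Longrightarrow> x \<in> carrier R \<Longrightarrow> x \<otimes> a \<in> I"
    and "\<And>a x. a \<in> I \<Longrightarrow> x \<in> carrier R \<Longrightarrow> a \<otimes> x \<in> I"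
  shows "ideal I R"
proof (rule idealI[OF ring_axioms])
  show "subgroup I (add_monoid R)"
  proof (rule add.subgroupI)
    show "\<ominus> a \<in> I" if "a \<in> I" for a
    proof -
      have "(\<ominus> \<one>) \<otimes> a \<in> I" using assms(4)[OF that, of "\<ominus> \<one>"] by simp
      moreover have "(\<ominus> \<one>) \<otimes> a = \<ominus> a" using that assms(1) by (auto simp: l_minus)
      ultimately show ?thesis by simp
    qed
  qed (use assms in auto)
qed (use assms in auto)

lemma ideal_minus_closed:
  "ideal P R \<Longrightarrow> x \<in> P \<Longrightarrow> y \<in> P \<Longrightarrow> x \<ominus> y \<in> P"
  unfolding a_minus_def by (meson additive_subgroup.a_closed additive_subgroup.a_inv_closed ideal.axioms(1))

lemma idem_compl:
  assumes "d \<in> carrier R" "d \<otimes> d = d"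
  shows "d \<otimes> (\<one> \<ominus> d) = \<zero>" "(\<one> \<ominus> d) \<otimes> d = \<zero>" "(\<one> \<ominus> d) \<otimes> (\<one> \<ominus> d) = \<one> \<ominus> d"
    "d \<oplus> (\<one> \<ominus> d) = \<one>"
proof -
  show 1: "d \<otimes> (\<one> \<ominus> d) = \<zero>" "(\<one> \<ominus> d) \<otimes> d = \<zero>"
    using assms by (simp_all add: a_minus_def r_distr l_distr r_minus l_minus r_neg)
  have "(\<one> \<ominus> d) \<otimes> (\<one> \<ominus> d) = (\<one> \<ominus> d) \<ominus> d \<otimes> (\<one> \<ominus> d)"
    using assms(1) by (simp add: a_minus_def l_distr l_minus)
  then show "(\<one> \<ominus> d) \<otimes> (\<one> \<ominus> d) = \<one> \<ominus> d" using 1 assms(1) by (simp add: a_minus_def)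
  show "d \<oplus> (\<one> \<ominus> d) = \<one>"
    using assms(1) by algebra
qed

text \<open>In the Peirce decomposition by \<open>d\<close> the first factor is \<open>p\<close> on
  the \<open>d\<close> part and \<open>s\<close> on the complement. As \<open>d\<close> commutes
  with \<open>q\<close> and \<open>s\<close>, the mixed terms vanish, and \<open>s\<close> is its
  own inverse. With \<open>s\<close> equal to 1 or -1 this builds units that agree with a given unit
  on the \<open>d\<close> part only.\<close>

lemma mult_split_idem:
  assumes d: "d \<in> carrier R" "d \<otimes> d = d"
    and pq: "p \<in> carrier R" "q \<in> carrier R" "p \<otimes> q = \<one>"
    and s: "s \<in> carrier R" "s \<otimes> s = \<one>"
    and comm: "d \<otimes> q = q \<otimes> d" "d \<otimes> s = s \<otimes> d"
  shows "(p \<otimes> d \<oplus> s \<otimes> (\<one> \<ominus> d)) \<otimes> (q \<otimes> d \<oplus> s \<otimes> (\<one> \<ominus> d)) = \<one>"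
proof -
  define c where "c = \<one> \<ominus> d"
  have c: "c \<in> carrier R" "d \<otimes> c = \<zero>" "c \<otimes> d = \<zero>" "c \<otimes> c = c" "d \<oplus> c = \<one>"
    using d idem_compl[OF d] by (simp_all add: c_def)
  have ck: "c \<otimes> q = q \<otimes> c" "c \<otimes> s = s \<otimes> c"
    using comm d pq s by (simp_all add: c_def a_minus_def l_distr r_distr l_minus r_minus)
  have "(p \<otimes> d) \<otimes> (q \<otimes> d) = p \<otimes> (d \<otimes> q) \<otimes> d" using pq d by (simp add: m_assoc)
  also have "\<dots> = (p \<otimes> q) \<otimes> (d \<otimes> d)" unfolding comm using pq(1,2) d(1) by (simp add: m_assoc)
  finally have 1: "(p \<otimes> d) \<otimes> (q \<otimes> d) = d" using pq d by simp
  have "(p \<otimes> d) \<otimes> (s \<otimes> c) = p \<otimes> (d \<otimes> s) \<otimes> c" using pq d c s by (simp add: m_assoc)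
  also have "\<dots> = (p \<otimes> s) \<otimes> (d \<otimes> c)" unfolding comm using pq d c s by (simp add: m_assoc)
  finally have 2: "(p \<otimes> d) \<otimes> (s \<otimes> c) = \<zero>" using pq s c by simp
  have "(s \<otimes> c) \<otimes> (q \<otimes> d) = s \<otimes> (c \<otimes> q) \<otimes> d" using pq d c s by (simp add: m_assoc)
  also have "\<dots> = (s \<otimes> q) \<otimes> (c \<otimes> d)" unfolding ck using pq d c s by (simp add: m_assoc)
  finally have 3: "(s \<otimes> c) \<otimes> (q \<otimes> d) = \<zero>" using pq s c by simp
  have "(s \<otimes> c) \<otimes> (s \<otimes> c) = s \<otimes> (c \<otimes> s) \<otimes> c" using c s by (simp add: m_assoc)
  also have "\<dots> = (s \<otimes> s) \<otimes> (c \<otimes> c)" unfolding ck using c(1) s(1) by (simp add: m_assoc)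
  finally have 4: "(s \<otimes> c) \<otimes> (s \<otimes> c) = c" using s c by simp
  show ?thesis
    unfolding c_def[symmetric] using pq s d c 1 2 3 4 by (simp add: l_distr r_distr)
qed

text \<open>Zorn's lemma applies because the union of a nonempty chain of ideals is an ideal, and it
  omits 1 if every member does.\<close>

lemma maximal_ideal_above:
  assumes "ideal I R" "\<one> \<notin> I"
  obtains P where "ideal P R" "I \<subseteq> P" "\<one> \<notin> P"
    "\<And>J. ideal J R \<Longrightarrow> P \<subseteq> J \<Longrightarrow> \<one> \<notin> J \<Longrightarrow> J = P"
proof -
  let ?A = "{P. ideal P R \<and> I \<subseteq> P \<and> \<one> \<notin> P}"
  have "\<exists>P\<in>?A. \<forall>X\<in>?A. P \<subseteq> X \<longrightarrow> X = P"
  proof (rule subset_Zorn_nonempty)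
    show "?A \<noteq> {}" using assms by auto
    fix C assume ne: "C \<noteq> {}" and ch: "subset.chain ?A C"
    have id: "ideal J R" "I \<subseteq> J" "\<one> \<notin> J" if "J \<in> C" for J
      using ch that unfolding subset.chain_def by auto
    have "ideal (\<Union>C) R"
    proof (rule idealI_closed)
      show "\<Union>C \<subseteq> carrier R" using ideal.Icarr[OF id(1)] by blast
      show "\<zero> \<in> \<Union>C" using ne additive_subgroup.zero_closed[OF ideal.axioms(1)[OF id(1)]] by blast
      fix a x assume a: "a \<in> \<Union>C"
      show "x \<otimes> a \<in> \<Union>C" "a \<otimes> x \<in> \<Union>C" if "x \<in> carrier R"
        using a that ideal.I_l_closed[OF id(1)] ideal.I_r_closed[OF id(1)] by blast+
      show "a \<oplus> x \<in> \<Union>C" if x: "x \<in> \<Union>C"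
      proof -
        obtain A B where "A \<in> C" "a \<in> A" "B \<in> C" "x \<in> B" using a x by auto
        then obtain D where "D \<in> C" "a \<in> D" "x \<in> D"
          using ch unfolding subset.chain_def by blast
        then show ?thesis using additive_subgroup.a_closed[OF ideal.axioms(1)[OF id(1)]] by blast
      qed
    qed
    then show "\<Union>C \<in> ?A" using id ne by blast
  qed
  then obtain P where "P \<in> ?A" "\<forall>X\<in>?A. P \<subseteq> X \<longrightarrow> X = P" by blast
  with that show thesis by blast
qed

end

section \<open>Subrings containing all units, and their conductor\<close>

locale unit_closed_subset = ring R for R (structure) +
  fixes T
  assumes T_subset: "T \<subseteq> carrier R"
    and T_add: "x \<in> T \<Longrightarrow> y \<in> T \<Longrightarrow> x \<oplus> y \<in> T"
    and T_mult: "x \<in> T \<Longrightarrow> y \<in> T \<Longrightarrow> x \<otimes> y \<in> T"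
    and T_Units: "Units R \<subseteq> T"
begin

text \<open>This is the largest two-sided ideal of \<open>R\<close> inside \<open>T\<close>. Testing
  single products \<open>a y b\<close> is enough because \<open>T\<close> is closed under
  addition.\<close>

definition conductor where
  "conductor = {y \<in> carrier R. \<forall>a\<in>carrier R. \<forall>b\<in>carrier R. a \<otimes> y \<otimes> b \<in> T}"

lemma conductorI:
  "y \<in> carrier R \<Longrightarrow> (\<And>a b. a \<in> carrier R \<Longrightarrow> b \<in> carrier R \<Longrightarrow> a \<otimes> y \<otimes> b \<in> T) \<Longrightarrow> y \<in> conductor"
  by (auto simp: conductor_def)

lemma conductor_carrier: "y \<in> conductor \<Longrightarrow> y \<in> carrier R"
  by (auto simp: conductor_def)

lemma conductor_subset_T: "conductor \<subseteq> T"
proof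
  fix y assume "y \<in> conductor"
  then have "\<one> \<otimes> y \<otimes> \<one> \<in> T" "y \<in> carrier R" unfolding conductor_def by blast+
  then show "y \<in> T" by simp
qed

lemma minus_one_Unit: "\<ominus> \<one> \<in> Units R"
  unfolding Units_def by (auto simp: l_minus r_minus intro!: bexI[of _ "\<ominus> \<one>"])

lemma T_neg: assumes "x \<in> T" shows "\<ominus> x \<in> T"
proof -
  have "(\<ominus> \<one>) \<otimes> x \<in> T" using assms T_mult T_Units minus_one_Unit by blast
  then show ?thesis using assms T_subset by (auto simp: l_minus)
qed

lemma T_minus: "x \<in> T \<Longrightarrow> y \<in> T \<Longrightarrow> x \<ominus> y \<in> T"
  by (simp add: a_minus_def T_add T_neg)

lemma T_zero: "\<zero> \<in> T"
proof -
  have "\<one> \<ominus> \<one> \<in> T" using T_minus T_Units by blast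
  then show ?thesis by (simp add: a_minus_def r_neg)
qed

lemma conductor_ideal: "ideal conductor R"
proof (rule idealI_closed)
  show "conductor \<subseteq> carrier R" by (auto simp: conductor_def)
  show "\<zero> \<in> conductor" by (auto simp: conductor_def T_zero)
  fix a x assume a: "a \<in> conductor"
  then have ac: "a \<in> carrier R" and aT: "\<And>u v. u \<in> carrier R \<Longrightarrow> v \<in> carrier R \<Longrightarrow> u \<otimes> a \<otimes> v \<in> T"
    by (auto simp: conductor_def)
  show "a \<oplus> x \<in> conductor" if x: "x \<in> conductor"
    using a x by (auto simp: conductor_def l_distr r_distr T_add)
  show "x \<otimes> a \<in> conductor" "a \<otimes> x \<in> conductor" if x: "x \<in> carrier R"
  proof -
    have "u \<otimes> (x \<otimes> a) \<otimes> v = (u \<otimes> x) \<otimes> a \<otimes> v" "u \<otimes> (a \<otimes> x) \<otimes> v = u \<otimes> a \<otimes> (x \<otimes> v)"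
      if "u \<in> carrier R" "v \<in> carrier R" for u v
      using that x ac by (simp_all add: m_assoc)
    then show "x \<otimes> a \<in> conductor" "a \<otimes> x \<in> conductor"
      using x ac aT by (auto simp: conductor_def)
  qed
qed

text \<open>The homomorphism is the indicator of the complement of an ideal \<open>P\<close> that is
  maximal among the proper ideals above the conductor. Multiplicativity is \<open>prime\<close>;
  additivity rests on \<open>alt\<close>, by which the residue ring has only two elements.\<close>

lemma F2_hom_if_central:
  assumes decomp: "\<And>x. x \<in> carrier R \<Longrightarrow> \<exists>u\<in>Units R. \<exists>f\<in>carrier R. f \<otimes> f = f \<and> x = u \<otimes> f"
    and central: "\<And>f x. f \<in> carrier R \<Longrightarrow> f \<otimes> f = f \<Longrightarrow> x \<in> carrier R \<Longrightarrow> f \<otimes> x = x \<otimes> f"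
    and proper: "T \<noteq> carrier R"
  shows "\<exists>\<phi>. F2_hom R \<phi>"
proof -
  have "\<one> \<notin> conductor"
  proof
    assume "\<one> \<in> conductor"
    then have "a \<in> T" if "a \<in> carrier R" for a
      using conductor_subset_T ideal.I_r_closed[OF conductor_ideal, of \<one> a] that by auto
    then show False using proper T_subset by auto
  qed
  then obtain P where P: "ideal P R" and CP: "conductor \<subseteq> P" and P1: "\<one> \<notin> P"
    and max: "\<And>J. ideal J R \<Longrightarrow> P \<subseteq> J \<Longrightarrow> \<one> \<notin> J \<Longrightarrow> J = P"
    using maximal_ideal_above[OF conductor_ideal] by metis
  interpret P: ideal P R by (rule P)
  note Pc = P.Icarr
  \<comment> \<open>Centrality makes the annihilator \<open>?J\<close> of \<open>f\<close> modulo
    \<open>P\<close> an ideal containing \<open>P\<close>. If \<open>f\<close> is outside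
    \<open>P\<close>, then \<open>?J\<close> is proper, so it equals \<open>P\<close> by maximality;
    but it contains \<open>1 - f\<close>.\<close>
  have idem: "f \<in> P \<or> \<one> \<ominus> f \<in> P" if f: "f \<in> carrier R" "f \<otimes> f = f" for f
  proof (rule ccontr)
    assume neg: "\<not> ?thesis"
    let ?J = "{y \<in> carrier R. f \<otimes> y \<in> P}"
    have "ideal ?J R"
    proof (rule idealI_closed)
      fix a x assume a: "a \<in> ?J"
      show "a \<oplus> x \<in> ?J" if "x \<in> ?J" using a that f by (auto simp: r_distr)
      show "x \<otimes> a \<in> ?J" if "x \<in> carrier R"
      proof -
        have "f \<otimes> (x \<otimes> a) = x \<otimes> (f \<otimes> a)"
          using central[OF f that] a f that by (auto simp flip: m_assoc)
        then show ?thesis using a that by (auto simp: P.I_l_closed)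
      qed
      show "a \<otimes> x \<in> ?J" if "x \<in> carrier R"
        using a that f P.I_r_closed by (auto simp flip: m_assoc)
    qed (use f in auto)
    moreover have "P \<subseteq> ?J" using Pc f by (auto simp: P.I_l_closed)
    moreover have "\<one> \<notin> ?J" using neg f by auto
    ultimately have "?J = P" using max by blast
    moreover have "f \<otimes> (\<one> \<ominus> f) = \<zero>" using f by (simp add: a_minus_def r_distr r_minus r_neg)
    then have "\<one> \<ominus> f \<in> ?J" using f by (auto)
    ultimately show False using neg by blast
  qed
  \<comment> \<open>In \<open>x = u f\<close> the idempotent \<open>f\<close> cannot lie in
    \<open>P\<close>, so it is congruent to 1 and \<open>x\<close> is congruent to
    \<open>u\<close>.\<close>
  have unit_mod: "\<exists>u\<in>Units R. x \<ominus> u \<in> P" if x: "x \<in> carrier R" "x \<notin> P" for x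
  proof -
    obtain u f where uf: "u \<in> Units R" "f \<in> carrier R" "f \<otimes> f = f" "x = u \<otimes> f" using decomp[OF x(1)] by blast
    have u: "u \<in> carrier R" using uf by blast
    have "f \<notin> P" using x uf u P.I_l_closed by auto
    then have "\<one> \<ominus> f \<in> P" using idem uf by blast
    then have "(\<ominus> u) \<otimes> (\<one> \<ominus> f) \<in> P" using u P.I_l_closed by blast
    moreover have "(\<ominus> u) \<otimes> (\<one> \<ominus> f) = x \<ominus> u" using u uf
      by (simp add: a_minus_def r_distr l_minus r_minus minus_add a_ac)
    ultimately show ?thesis using uf by auto
  qed
  have Units_cancel: "y \<in> P" if "u \<in> Units R" "y \<in> carrier R" "u \<otimes> y \<in> P" for u y
  proof -
    have "inv u \<otimes> (u \<otimes> y) \<in> P" using that P.I_l_closed by blast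
    moreover have "inv u \<otimes> (u \<otimes> y) = y"
      using that(2) m_assoc[of "inv u" u y] Units_l_inv[OF that(1)] Units_closed[OF that(1)] Units_inv_closed[OF that(1)] by simp
    ultimately show ?thesis by simp
  qed
  have prime: "x \<otimes> y \<notin> P" if x: "x \<in> carrier R" "x \<notin> P" and y: "y \<in> carrier R" "y \<notin> P" for x y
  proof
    assume xy: "x \<otimes> y \<in> P"
    obtain u where u: "u \<in> Units R" "x \<ominus> u \<in> P" using unit_mod x by blast
    have uc: "u \<in> carrier R" using u by blast
    have "x \<otimes> y \<ominus> (x \<ominus> u) \<otimes> y \<in> P"
      using ideal_minus_closed[OF P xy] u y P.I_r_closed by blast
    moreover have "x \<otimes> y \<ominus> (x \<ominus> u) \<otimes> y = u \<otimes> y"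
      using x y uc by (simp add: a_minus_def l_distr l_minus minus_add r_neg1 flip: a_assoc) (simp add: r_neg)
    ultimately show False using Units_cancel u y by auto
  qed
  \<comment> \<open>Suppose both \<open>a\<close> and \<open>1 - a\<close> lie outside
    \<open>P\<close>. The product \<open>?e\<close> of their idempotents is then outside
    \<open>P\<close> by primeness, whereas it will turn out to lie in the conductor, which is
    contained in \<open>P\<close>.\<close>
  have alt: "a \<in> P \<or> \<one> \<ominus> a \<in> P" if a: "a \<in> carrier R" for a
  proof (rule ccontr)
    assume neg: "\<not> ?thesis"
    obtain u f where uf: "u \<in> Units R" "f \<in> carrier R" "f \<otimes> f = f" "a = u \<otimes> f" using decomp[OF a(1)] by blast
    obtain v g where vg: "v \<in> Units R" "g \<in> carrier R" "g \<otimes> g = g" "\<one> \<ominus> a = v \<otimes> g"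
      using decomp[of "\<one> \<ominus> a"] a by auto
    have c: "u \<in> carrier R" "v \<in> carrier R" using uf vg by auto
    let ?e = "f \<otimes> g"
    have "f \<notin> P" "g \<notin> P" using neg c uf vg P.I_l_closed by auto
    then have eP: "?e \<notin> P" using prime uf vg by blast
    \<comment> \<open>Below both \<open>f\<close> and \<open>g\<close>, the products
      \<open>u d\<close> and \<open>v d\<close> become \<open>a d\<close> and
      \<open>(1 - a) d\<close>, with sum \<open>d\<close>. Completing them by \<open>1 - d\<close>
      and \<open>-(1 - d)\<close> gives two units whose extra parts cancel, so \<open>d\<close> is a
      sum of two units.\<close>
    have below: "d \<in> T" if d: "d \<in> carrier R" "d \<otimes> d = d" "f \<otimes> d = d" "g \<otimes> d = d" for d
    proof -
      have unit: "w \<otimes> d \<oplus> s \<otimes> (\<one> \<ominus> d) \<in> Units R"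
        if w: "w \<in> Units R" and s: "s \<in> carrier R" "s \<otimes> s = \<one>" for w s
      proof -
        have c: "w \<in> carrier R" "inv w \<in> carrier R" "w \<otimes> inv w = \<one>" "inv w \<otimes> w = \<one>" using w by auto
        have "(w \<otimes> d \<oplus> s \<otimes> (\<one> \<ominus> d)) \<otimes> (inv w \<otimes> d \<oplus> s \<otimes> (\<one> \<ominus> d)) = \<one>"
          using mult_split_idem[OF d(1,2) c(1,2,3) s central[OF d(1,2)] central[OF d(1,2)]] c s by blast
        moreover have "(inv w \<otimes> d \<oplus> s \<otimes> (\<one> \<ominus> d)) \<otimes> (w \<otimes> d \<oplus> s \<otimes> (\<one> \<ominus> d)) = \<one>"
          using mult_split_idem[OF d(1,2) c(2,1,4) s central[OF d(1,2)] central[OF d(1,2)]] c s by blast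
        ultimately show ?thesis using c d(1) s(1) unfolding Units_def by blast
      qed
      have "u \<otimes> d \<oplus> \<one> \<otimes> (\<one> \<ominus> d) \<in> T" "v \<otimes> d \<oplus> (\<ominus> \<one>) \<otimes> (\<one> \<ominus> d) \<in> T"
        using unit[OF uf(1), of \<one>] unit[OF vg(1), of "\<ominus> \<one>"] T_Units by (auto simp: l_minus)
      then have "(u \<otimes> d \<oplus> \<one> \<otimes> (\<one> \<ominus> d)) \<oplus> (v \<otimes> d \<oplus> (\<ominus> \<one>) \<otimes> (\<one> \<ominus> d)) \<in> T" by (rule T_add)
      moreover have "u \<otimes> d = a \<otimes> d" "v \<otimes> d = (\<one> \<ominus> a) \<otimes> d"
        using uf vg c d by (auto simp: m_assoc)
      moreover have "(a \<otimes> d \<oplus> \<one> \<otimes> (\<one> \<ominus> d)) \<oplus> ((\<one> \<ominus> a) \<otimes> d \<oplus> (\<ominus> \<one>) \<otimes> (\<one> \<ominus> d)) = d"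
        using a d(1) by algebra
      ultimately show ?thesis by simp
    qed
    have "?e \<in> conductor"
    proof (rule conductorI)
      \<comment> \<open>Since \<open>?e\<close> is central,
        \<open>p ?e q = (p q) ?e = w (h ?e)\<close>, a unit times an idempotent below both
        \<open>f\<close> and \<open>g\<close>.\<close>
      fix p q assume pq: "p \<in> carrier R" "q \<in> carrier R"
      obtain w h where wh: "w \<in> Units R" "h \<in> carrier R" "h \<otimes> h = h" "p \<otimes> q = w \<otimes> h"
        using decomp[of "p \<otimes> q"] pq by auto
      have fc: "\<And>x. x \<in> carrier R \<Longrightarrow> f \<otimes> x = x \<otimes> f" and gc: "\<And>x. x \<in> carrier R \<Longrightarrow> g \<otimes> x = x \<otimes> g"
        using central uf vg by auto
      let ?d = "h \<otimes> ?e"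
      have e: "?e \<in> carrier R" using uf vg by blast
      have fe: "f \<otimes> ?e = ?e" using uf vg by (simp flip: m_assoc)
      have ge: "g \<otimes> ?e = ?e" using m_assoc[OF vg(2) uf(2) vg(2)] m_assoc[OF uf(2) vg(2) vg(2)] gc[OF uf(2)] vg(3) by simp
      have ec: "?e \<otimes> x = x \<otimes> ?e" if "x \<in> carrier R" for x
      proof -
        have "?e \<otimes> x = f \<otimes> (x \<otimes> g)" using that uf(2) vg(2) gc by (simp add: m_assoc)
        also have "\<dots> = x \<otimes> ?e" using that uf(2) vg(2) fc[OF that] by (simp flip: m_assoc)
        finally show ?thesis .
      qed
      have ee: "?e \<otimes> ?e = ?e" using fe ge uf(2) vg(2) e by (simp add: m_assoc)
      have "?d \<in> T"
      proof (rule below)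
        show "?d \<in> carrier R" using wh e by blast
        have "?d \<otimes> ?d = h \<otimes> (?e \<otimes> h) \<otimes> ?e" using wh e uf(2) vg(2) by (simp add: m_assoc)
        also have "\<dots> = (h \<otimes> h) \<otimes> (?e \<otimes> ?e)" unfolding ec[OF wh(2)] using wh(2) uf(2) vg(2) by (simp add: m_assoc)
        finally show "?d \<otimes> ?d = ?d" using wh ee by simp
        have "f \<otimes> ?d = h \<otimes> (f \<otimes> ?e)" using m_assoc[OF uf(2) wh(2) e] m_assoc[OF wh(2) uf(2) e] fc[OF wh(2)] by simp
        then show "f \<otimes> ?d = ?d" using fe by simp
        have "g \<otimes> ?d = h \<otimes> (g \<otimes> ?e)" using m_assoc[OF vg(2) wh(2) e] m_assoc[OF wh(2) vg(2) e] gc[OF wh(2)] by simp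
        then show "g \<otimes> ?d = ?d" using ge by simp
      qed
      then have "w \<otimes> ?d \<in> T" using T_mult T_Units wh by blast
      moreover have "p \<otimes> ?e \<otimes> q = (p \<otimes> q) \<otimes> ?e" using m_assoc[OF pq(1) e pq(2)] m_assoc[OF pq(1) pq(2) e] ec[OF pq(2)] by simp
      moreover have "\<dots> = w \<otimes> ?d" unfolding wh(4) using wh(1,2) e m_assoc[of w h ?e] by (simp add: Units_closed)
      ultimately show "p \<otimes> ?e \<otimes> q \<in> T" by simp
    qed (use uf vg in auto)
    then show False using eP CP by blast
  qed
  have "F2_hom R (\<lambda>x. x \<notin> P)"
    unfolding F2_hom_def
  proof (intro conjI ballI)
    show "\<one> \<notin> P" by (rule P1)
    fix x y assume xy: "x \<in> carrier R" "y \<in> carrier R"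
    show "(x \<otimes> y \<notin> P) = (x \<notin> P \<and> y \<notin> P)"
      using prime[OF xy(1) _ xy(2)] P.I_l_closed[OF _ xy(1), of y] P.I_r_closed[OF _ xy(2), of x] by auto
    show "(x \<oplus> y \<notin> P) = ((x \<notin> P) \<noteq> (y \<notin> P))"
    proof -
      have r1: "x \<oplus> y \<notin> P" if "x \<in> P" "y \<notin> P"
      proof
        assume "x \<oplus> y \<in> P"
        then have "(x \<oplus> y) \<ominus> x \<in> P" using that ideal_minus_closed[OF P] by blast
        moreover have "(x \<oplus> y) \<ominus> x = y" "(x \<oplus> y) \<ominus> y = x" using xy by algebra+
        ultimately show False using that by simp
      qed
      have r2: "x \<oplus> y \<notin> P" if "y \<in> P" "x \<notin> P"
      proof
        assume "x \<oplus> y \<in> P"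
        then have "(x \<oplus> y) \<ominus> y \<in> P" using that ideal_minus_closed[OF P] by blast
        moreover have "(x \<oplus> y) \<ominus> x = y" "(x \<oplus> y) \<ominus> y = x" using xy by algebra+
        ultimately show False using that by simp
      qed
      \<comment> \<open>Here \<open>x + y = 2 - (1 - x) - (1 - y)\<close>. The element 2 lies in
        \<open>P\<close> by \<open>alt\<close> at -1, because the unit -1 does not lie in
        \<open>P\<close>.\<close>
      have r3: "x \<oplus> y \<in> P" if "x \<notin> P" "y \<notin> P"
      proof -
        have m: "\<one> \<ominus> x \<in> P" "\<one> \<ominus> y \<in> P" using alt xy that by auto
        have "\<ominus> \<one> \<notin> P"
          using Units_cancel[OF minus_one_Unit, of \<one>] P1 by auto
        then have "\<one> \<ominus> (\<ominus> \<one>) \<in> P" using alt by blast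
        then have "\<one> \<ominus> (\<ominus> \<one>) \<ominus> (\<one> \<ominus> x) \<ominus> (\<one> \<ominus> y) \<in> P"
          using m ideal_minus_closed[OF P] by blast
        moreover have "\<one> \<ominus> (\<ominus> \<one>) \<ominus> (\<one> \<ominus> x) \<ominus> (\<one> \<ominus> y) = x \<oplus> y"
          using xy by algebra
        ultimately show ?thesis by simp
      qed
      show ?thesis using r1 r2 r3 by auto
    qed
  qed
  then show ?thesis by blast
qed

text \<open>The element \<open>1 + n\<close> is a unit with inverse \<open>1 - n\<close>, and
  \<open>n\<close> is its difference with 1.\<close>

lemma square_zero_in_T:
  assumes n: "n \<in> carrier R" "n \<otimes> n = \<zero>"
  shows "n \<in> T"
proof -
  have "(\<one> \<oplus> n) \<otimes> (\<one> \<ominus> n) = \<one>" "(\<one> \<ominus> n) \<otimes> (\<one> \<oplus> n) = \<one>"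
    using n by (simp_all add: a_minus_def l_distr r_distr l_minus r_minus a_assoc l_neg r_neg)
  then have "\<one> \<oplus> n \<in> Units R" using n(1) unfolding Units_def by blast
  then have "(\<one> \<oplus> n) \<ominus> \<one> \<in> T" using T_Units T_minus by blast
  moreover have "(\<one> \<oplus> n) \<ominus> \<one> = n" using n(1) by algebra
  ultimately show ?thesis by simp
qed

text \<open>Split \<open>a (e s e') b\<close> into its four Peirce components. The off-diagonal ones
  square to zero and hence lie in \<open>T\<close>. Each diagonal one factors through the other
  idempotent as a product of two off-diagonal elements, for example
  \<open>(e (a e s) e') (e' b e)\<close>. The symmetric hypotheses on \<open>e\<close> and
  \<open>e'\<close> let the lemma serve both off-diagonal corners.\<close>

lemma corner_in_conductor:
  assumes e: "e \<in> carrier R" "e' \<in> carrier R" "e \<otimes> e = e" "e' \<otimes> e' = e'"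
    "e \<otimes> e' = \<zero>" "e' \<otimes> e = \<zero>" "e \<oplus> e' = \<one>"
    and s: "s \<in> carrier R"
  shows "e \<otimes> s \<otimes> e' \<in> conductor"
proof (rule conductorI)
  have corner: "p \<otimes> x \<otimes> q \<in> T"
    if "p \<in> carrier R" "q \<in> carrier R" "q \<otimes> p = \<zero>" "x \<in> carrier R" for p q x
  proof (rule square_zero_in_T)
    have "p \<otimes> x \<otimes> q \<otimes> (p \<otimes> x \<otimes> q) = p \<otimes> x \<otimes> (q \<otimes> p) \<otimes> x \<otimes> q"
      using that(1,2,4) by (simp add: m_assoc)
    then show "p \<otimes> x \<otimes> q \<otimes> (p \<otimes> x \<otimes> q) = \<zero>" using that by simp
  qed (use that in simp)
  fix a b assume ab: "a \<in> carrier R" "b \<in> carrier R"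
  let ?X = "a \<otimes> (e \<otimes> s \<otimes> e') \<otimes> b"
  have X: "?X \<in> carrier R" using ab e s by simp
  have "e \<otimes> ?X \<otimes> e = (e \<otimes> (a \<otimes> e \<otimes> s) \<otimes> (e' \<otimes> e')) \<otimes> b \<otimes> e"
    unfolding e(4) using ab e(1,2) s by (simp add: m_assoc)
  also have "\<dots> = (e \<otimes> (a \<otimes> e \<otimes> s) \<otimes> e') \<otimes> (e' \<otimes> b \<otimes> e)"
    using ab e(1,2) s by (simp add: m_assoc)
  finally have 1: "e \<otimes> ?X \<otimes> e \<in> T" using corner e ab s T_mult by simp
  have "e' \<otimes> ?X \<otimes> e' = e' \<otimes> a \<otimes> (e \<otimes> e) \<otimes> (s \<otimes> e' \<otimes> b) \<otimes> e'"
    unfolding e(3) using ab e(1,2) s by (simp add: m_assoc)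
  also have "\<dots> = (e' \<otimes> a \<otimes> e) \<otimes> (e \<otimes> (s \<otimes> e' \<otimes> b) \<otimes> e')"
    using ab e(1,2) s by (simp add: m_assoc)
  finally have 2: "e' \<otimes> ?X \<otimes> e' \<in> T" using corner e ab s T_mult by simp
  have 3: "e \<otimes> ?X \<otimes> e' \<in> T" "e' \<otimes> ?X \<otimes> e \<in> T" using corner e X by auto
  have "?X = (e \<oplus> e') \<otimes> ?X \<otimes> (e \<oplus> e')" unfolding e(7) using X by simp
  also have "\<dots> = (e \<otimes> ?X \<otimes> e \<oplus> e \<otimes> ?X \<otimes> e') \<oplus> (e' \<otimes> ?X \<otimes> e \<oplus> e' \<otimes> ?X \<otimes> e')"
    using X e(1,2) by algebra
  also have "\<dots> \<in> T" by (intro T_add 1 2 3)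
  finally show "?X \<in> T" .
qed (use e s in simp)

text \<open>\<open>F2_hom_if_central\<close> is applied to the quotient by the conductor. The
  decomposition of elements of \<open>R\<close> is what lifts units and idempotents of the quotient
  back to \<open>R\<close>.\<close>

theorem F2_hom_if_decomp:
  assumes decomp: "\<And>x. x \<in> carrier R \<Longrightarrow>
      \<exists>u\<in>Units R. \<exists>f\<in>carrier R. f \<otimes> f = f \<and> x \<ominus> u \<otimes> f \<in> conductor"
    and proper: "T \<noteq> carrier R"
  shows "\<exists>\<psi>. F2_hom R \<psi> \<and> (\<forall>y\<in>conductor. \<not> \<psi> y)"
proof -
  let ?Q = "R Quot conductor" and ?\<pi> = "(+>) conductor"
  interpret C: ideal conductor R by (rule conductor_ideal)
  interpret h: ring_hom_ring R ?Q ?\<pi> by (rule C.rcos_ring_hom_ring)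
  have eq: "?\<pi> x = ?\<pi> y \<longleftrightarrow> x \<ominus> y \<in> conductor" if "x \<in> carrier R" "y \<in> carrier R" for x y
    using quotient_eq_iff_same_a_r_cos[OF conductor_ideal that] by auto
  have surj: "\<exists>x\<in>carrier R. X = ?\<pi> x" if "X \<in> carrier ?Q" for X
    using that unfolding FactRing_def A_RCOSETS_def' by auto
  have img: "?\<pi> u \<in> Units ?Q" if u: "u \<in> Units R" for u
  proof -
    have "?\<pi> u \<otimes>\<^bsub>?Q\<^esub> ?\<pi> (inv u) = \<one>\<^bsub>?Q\<^esub>" "?\<pi> (inv u) \<otimes>\<^bsub>?Q\<^esub> ?\<pi> u = \<one>\<^bsub>?Q\<^esub>"
      using u h.hom_mult[of u "inv u"] h.hom_mult[of "inv u" u] h.hom_one by auto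
    moreover have "?\<pi> u \<in> carrier ?Q" "?\<pi> (inv u) \<in> carrier ?Q" using u by auto
    ultimately show ?thesis unfolding Units_def by blast
  qed
  \<comment> \<open>The commutator is a difference of two corners:
    \<open>f x - x f = f x (1 - f) - (1 - f) x f\<close>.\<close>
  have central0: "?\<pi> f \<otimes>\<^bsub>?Q\<^esub> X = X \<otimes>\<^bsub>?Q\<^esub> ?\<pi> f"
    if f: "f \<in> carrier R" "f \<otimes> f = f" and X: "X \<in> carrier ?Q" for f X
  proof -
    obtain x where x: "x \<in> carrier R" "X = ?\<pi> x" using surj X by blast
    note ic = idem_compl[OF f]
    have "f \<otimes> x \<otimes> (\<one> \<ominus> f) \<in> conductor" "(\<one> \<ominus> f) \<otimes> x \<otimes> f \<in> conductor"
      using corner_in_conductor[of f "\<one> \<ominus> f" x] corner_in_conductor[of "\<one> \<ominus> f" f x] f x ic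
      by (simp_all add: a_comm)
    then have "f \<otimes> x \<otimes> (\<one> \<ominus> f) \<ominus> (\<one> \<ominus> f) \<otimes> x \<otimes> f \<in> conductor"
      by (rule ideal_minus_closed[OF conductor_ideal])
    moreover have "f \<otimes> x \<otimes> (\<one> \<ominus> f) = f \<otimes> x \<ominus> f \<otimes> x \<otimes> f" "(\<one> \<ominus> f) \<otimes> x \<otimes> f = x \<otimes> f \<ominus> f \<otimes> x \<otimes> f"
      using f(1) x(1) by (simp_all add: a_minus_def l_distr r_distr l_minus r_minus)
    moreover have "(f \<otimes> x \<ominus> f \<otimes> x \<otimes> f) \<ominus> (x \<otimes> f \<ominus> f \<otimes> x \<otimes> f) = f \<otimes> x \<ominus> x \<otimes> f"
      using f(1) x(1) by algebra
    ultimately have "?\<pi> (f \<otimes> x) = ?\<pi> (x \<otimes> f)" using eq[of "f \<otimes> x" "x \<otimes> f"] f x by (simp del: h.hom_mult)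
    then show ?thesis using f x by simp
  qed
  have decompQ: "\<exists>u\<in>Units R. \<exists>f\<in>carrier R. f \<otimes> f = f \<and> X = ?\<pi> u \<otimes>\<^bsub>?Q\<^esub> ?\<pi> f"
    if X: "X \<in> carrier ?Q" for X
  proof -
    obtain x where x: "x \<in> carrier R" "X = ?\<pi> x" using surj X by blast
    obtain u f where uf: "u \<in> Units R" "f \<in> carrier R" "f \<otimes> f = f" "x \<ominus> u \<otimes> f \<in> conductor"
      using decomp[OF x(1)] by blast
    then have "?\<pi> x = ?\<pi> (u \<otimes> f)" using eq[of x "u \<otimes> f"] x Units_closed by (simp del: h.hom_mult)
    then show ?thesis using h.hom_mult[OF Units_closed[OF uf(1)] uf(2)] uf(1-3) x(2) by metis
  qed
  have idemQ: "?\<pi> f \<otimes>\<^bsub>?Q\<^esub> ?\<pi> f = ?\<pi> f" if "f \<in> carrier R" "f \<otimes> f = f" for f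
    using that h.hom_mult[of f f] by simp
  interpret Q: unit_closed_subset ?Q "?\<pi> ` T"
  proof
    show "?\<pi> ` T \<subseteq> carrier ?Q" using T_subset by auto
    show "X \<oplus>\<^bsub>?Q\<^esub> Y \<in> ?\<pi> ` T" "X \<otimes>\<^bsub>?Q\<^esub> Y \<in> ?\<pi> ` T" if XY: "X \<in> ?\<pi> ` T" "Y \<in> ?\<pi> ` T" for X Y
    proof -
      obtain x y where xy: "x \<in> T" "y \<in> T" "X = ?\<pi> x" "Y = ?\<pi> y" using XY by blast
      then have "X \<oplus>\<^bsub>?Q\<^esub> Y = ?\<pi> (x \<oplus> y)" "X \<otimes>\<^bsub>?Q\<^esub> Y = ?\<pi> (x \<otimes> y)"
        using T_subset by (simp_all add: subsetD)
      then show "X \<oplus>\<^bsub>?Q\<^esub> Y \<in> ?\<pi> ` T" "X \<otimes>\<^bsub>?Q\<^esub> Y \<in> ?\<pi> ` T"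
        using xy T_add T_mult by auto
    qed
    show "Units ?Q \<subseteq> ?\<pi> ` T"
    proof
      fix X assume X: "X \<in> Units ?Q"
      then have Xc: "X \<in> carrier ?Q" by (rule h.S.Units_closed)
      obtain u f where uf: "u \<in> Units R" "f \<in> carrier R" "f \<otimes> f = f" "X = ?\<pi> u \<otimes>\<^bsub>?Q\<^esub> ?\<pi> f"
        using decompQ[OF Xc] by blast
      have c: "?\<pi> u \<in> carrier ?Q" "?\<pi> f \<in> carrier ?Q" using uf by auto
      \<comment> \<open>Cancelling the unit \<open>X\<close> shows that the class of
        \<open>f\<close> is 1, so \<open>X\<close> is the class of the unit \<open>u\<close> of
        \<open>R\<close>, which lies in \<open>T\<close>.\<close>
      have "X \<otimes>\<^bsub>?Q\<^esub> ?\<pi> f = X" using uf(4) c idemQ[OF uf(2,3)] by (simp add: h.S.m_assoc)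
      then have "X \<otimes>\<^bsub>?Q\<^esub> ?\<pi> f = X \<otimes>\<^bsub>?Q\<^esub> \<one>\<^bsub>?Q\<^esub>" using Xc by simp
      then have "?\<pi> f = \<one>\<^bsub>?Q\<^esub>" using X c by (simp add: h.S.Units_l_cancel)
      then show "X \<in> ?\<pi> ` T" using uf c T_Units by auto
    qed
  qed
  have "\<exists>\<phi>. F2_hom ?Q \<phi>"
  proof (rule Q.F2_hom_if_central)
    fix X assume X: "X \<in> carrier ?Q"
    show "\<exists>u\<in>Units ?Q. \<exists>f\<in>carrier ?Q. f \<otimes>\<^bsub>?Q\<^esub> f = f \<and> X = u \<otimes>\<^bsub>?Q\<^esub> f"
      using decompQ[OF X] img idemQ h.hom_closed by metis
  next
    fix F X assume F: "F \<in> carrier ?Q" "F \<otimes>\<^bsub>?Q\<^esub> F = F" and X: "X \<in> carrier ?Q"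
    obtain u f where uf: "u \<in> Units R" "f \<in> carrier R" "f \<otimes> f = f" "F = ?\<pi> u \<otimes>\<^bsub>?Q\<^esub> ?\<pi> f"
      using decompQ[OF F(1)] by blast
    have U: "?\<pi> u \<in> Units ?Q" "?\<pi> u \<in> carrier ?Q" and fc: "?\<pi> f \<in> carrier ?Q" using uf img by auto
    \<comment> \<open>Since the class of \<open>f\<close> is central, \<open>F = F F = u F\<close>.
      Comparing with \<open>F = u f\<close> and cancelling \<open>u\<close> shows that
      \<open>F\<close> is the class of an idempotent of \<open>R\<close>, to which
      \<open>central0\<close> applies.\<close>
    have "F \<otimes>\<^bsub>?Q\<^esub> F = ?\<pi> u \<otimes>\<^bsub>?Q\<^esub> (?\<pi> f \<otimes>\<^bsub>?Q\<^esub> F)"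
      using uf(4) U fc F(1) by (simp add: h.S.m_assoc)
    also have "?\<pi> f \<otimes>\<^bsub>?Q\<^esub> F = F \<otimes>\<^bsub>?Q\<^esub> ?\<pi> f" using central0 uf F by blast
    also have "\<dots> = F" using uf(4) U fc idemQ[OF uf(2,3)] by (simp add: h.S.m_assoc)
    finally have "?\<pi> u \<otimes>\<^bsub>?Q\<^esub> F = ?\<pi> u \<otimes>\<^bsub>?Q\<^esub> ?\<pi> f" using F uf by simp
    then have "F = ?\<pi> f" using U fc F by (simp add: h.S.Units_l_cancel)
    then show "F \<otimes>\<^bsub>?Q\<^esub> X = X \<otimes>\<^bsub>?Q\<^esub> F" using central0 uf X by simp
  next
    show "?\<pi> ` T \<noteq> carrier ?Q"
    proof
      assume a: "?\<pi> ` T = carrier ?Q"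
      \<comment> \<open>The conductor is contained in \<open>T\<close>, so \<open>T\<close> is the
        full preimage of its image.\<close>
      have "x \<in> T" if x: "x \<in> carrier R" for x
      proof -
        have "?\<pi> x \<in> ?\<pi> ` T" using a h.hom_closed[OF x] by simp
        then obtain t where t: "t \<in> T" "?\<pi> x = ?\<pi> t" by blast
        have tc: "t \<in> carrier R" using t T_subset by blast
        have "x \<ominus> t \<in> T" using eq[OF x tc] t conductor_subset_T by blast
        then have "(x \<ominus> t) \<oplus> t \<in> T" using t T_add by blast
        moreover have "(x \<ominus> t) \<oplus> t = x" using x tc by algebra
        ultimately show ?thesis by simp
      qed
      then show False using proper T_subset by blast
    qed
  qed
  then obtain \<phi> where \<phi>: "F2_hom ?Q \<phi>" by blast
  have "F2_hom R (\<phi> \<circ> ?\<pi>)"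
    using \<phi> unfolding F2_hom_def comp_def by simp
  moreover have "\<not> \<phi> (?\<pi> y)" if y: "y \<in> conductor" for y
  proof -
    have "?\<pi> y = ?\<pi> \<zero>" using eq[of y \<zero>] y conductor_carrier by (simp add: a_minus_def)
    then have z: "?\<pi> y = \<zero>\<^bsub>?Q\<^esub>" using h.hom_zero by simp
    have "\<phi> (\<zero>\<^bsub>?Q\<^esub> \<oplus>\<^bsub>?Q\<^esub> \<zero>\<^bsub>?Q\<^esub>) = (\<phi> \<zero>\<^bsub>?Q\<^esub> \<noteq> \<phi> \<zero>\<^bsub>?Q\<^esub>)"
      using \<phi> h.S.zero_closed unfolding F2_hom_def by blast
    then show ?thesis using z by simp
  qed
  ultimately show ?thesis by (auto intro!: exI[of _ "\<phi> \<circ> ?\<pi>"])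
qed

end

section \<open>Modules and their endomorphism rings\<close>

text \<open>Only the additive part of this record is meaningful; the multiplicative fields are junk.\<close>

definition mgroup :: "('r, 'm, 'b) rmodule_scheme \<Rightarrow> 'm ring" where
  "mgroup M = \<lparr>carrier = mcarrier M, monoid.mult = (\<lambda>x y. mzero M), one = mzero M,
     ring.zero = mzero M, ring.add = madd M\<rparr>"

lemma mgroup_simps:
  "carrier (mgroup M) = mcarrier M" "\<zero>\<^bsub>mgroup M\<^esub> = mzero M" "x \<oplus>\<^bsub>mgroup M\<^esub> y = madd M x y"
  by (simp_all add: mgroup_def)

text \<open>Restricting to extensional functions gives every endomorphism a single representative,
  so that ring equality means agreement on the module's carrier.\<close>

definition endo_ring :: "('r, 'a) ring_scheme \<Rightarrow> ('r, 'm, 'b) rmodule_scheme \<Rightarrow> ('m \<Rightarrow> 'm) ring" where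
  "endo_ring R M = \<lparr>carrier = {f \<in> extensional (mcarrier M). rhom R M M f},
     monoid.mult = (\<lambda>f g. \<lambda>x\<in>mcarrier M. f (g x)), one = (\<lambda>x\<in>mcarrier M. x),
     ring.zero = (\<lambda>x\<in>mcarrier M. mzero M), ring.add = (\<lambda>f g. \<lambda>x\<in>mcarrier M. madd M (f x) (g x))\<rparr>"

locale rmod =
  fixes R :: "('r, 'a) ring_scheme" and E :: "('r, 'm, 'b) rmodule_scheme"
  assumes right_module: "right_module R E"
begin

sublocale R: ring R
  using right_module by (simp add: right_module_def)

abbreviation "G \<equiv> mgroup E"
abbreviation "S \<equiv> endo_ring R E"
abbreviation smult (infixl "\<cdot>" 75) where "x \<cdot> r \<equiv> mact E x r"

sublocale G: abelian_group G
proof (rule abelian_groupI)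
  show "\<exists>y\<in>carrier G. y \<oplus>\<^bsub>G\<^esub> x = \<zero>\<^bsub>G\<^esub>" if "x \<in> carrier G" for x
    using right_module that unfolding right_module_def mgroup_simps by metis
qed (use right_module in \<open>auto simp: right_module_def mgroup_simps\<close>)

section \<open>Module arithmetic and submodules\<close>

lemma smult_closed [simp]: "x \<in> carrier G \<Longrightarrow> r \<in> carrier R \<Longrightarrow> x \<cdot> r \<in> carrier G"
  using right_module by (simp add: right_module_def mgroup_simps)

lemma smult_l_distr: "x \<in> carrier G \<Longrightarrow> y \<in> carrier G \<Longrightarrow> r \<in> carrier R \<Longrightarrow>
    (x \<oplus>\<^bsub>G\<^esub> y) \<cdot> r = x \<cdot> r \<oplus>\<^bsub>G\<^esub> y \<cdot> r"
  using right_module by (simp add: right_module_def mgroup_simps)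

lemma smult_r_distr: "x \<in> carrier G \<Longrightarrow> r \<in> carrier R \<Longrightarrow> s \<in> carrier R \<Longrightarrow>
    x \<cdot> (r \<oplus>\<^bsub>R\<^esub> s) = x \<cdot> r \<oplus>\<^bsub>G\<^esub> x \<cdot> s"
  using right_module by (simp add: right_module_def mgroup_simps)

lemma smult_assoc: "x \<in> carrier G \<Longrightarrow> r \<in> carrier R \<Longrightarrow> s \<in> carrier R \<Longrightarrow>
    x \<cdot> (r \<otimes>\<^bsub>R\<^esub> s) = x \<cdot> r \<cdot> s"
  using right_module by (simp add: right_module_def mgroup_simps)

lemma smult_one [simp]: "x \<in> carrier G \<Longrightarrow> x \<cdot> \<one>\<^bsub>R\<^esub> = x"
  using right_module by (simp add: right_module_def mgroup_simps)

lemma smult_zero [simp]: assumes "x \<in> carrier G" shows "x \<cdot> \<zero>\<^bsub>R\<^esub> = \<zero>\<^bsub>G\<^esub>"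
proof -
  have "x \<cdot> \<zero>\<^bsub>R\<^esub> \<oplus>\<^bsub>G\<^esub> x \<cdot> \<zero>\<^bsub>R\<^esub> = x \<cdot> \<zero>\<^bsub>R\<^esub>"
    using smult_r_distr[OF assms, of "\<zero>\<^bsub>R\<^esub>" "\<zero>\<^bsub>R\<^esub>"] by simp
  then show ?thesis using assms by (metis G.add.l_cancel_one' R.zero_closed smult_closed)
qed

lemma zero_smult [simp]: assumes "r \<in> carrier R" shows "\<zero>\<^bsub>G\<^esub> \<cdot> r = \<zero>\<^bsub>G\<^esub>"
proof -
  have "\<zero>\<^bsub>G\<^esub> \<cdot> r \<oplus>\<^bsub>G\<^esub> \<zero>\<^bsub>G\<^esub> \<cdot> r = \<zero>\<^bsub>G\<^esub> \<cdot> r"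
    using smult_l_distr[of "\<zero>\<^bsub>G\<^esub>" "\<zero>\<^bsub>G\<^esub>" r] assms by simp
  then show ?thesis using assms by (metis G.add.l_cancel_one' G.zero_closed smult_closed)
qed

text \<open>Negation is a scalar action. Hence submodules and homomorphisms respect it, although
  their definitions do not list it.\<close>

lemma smult_minus_one:
  assumes "x \<in> carrier G" shows "x \<cdot> (\<ominus>\<^bsub>R\<^esub> \<one>\<^bsub>R\<^esub>) = \<ominus>\<^bsub>G\<^esub> x"
proof -
  have "x \<cdot> (\<ominus>\<^bsub>R\<^esub> \<one>\<^bsub>R\<^esub>) \<oplus>\<^bsub>G\<^esub> x \<cdot> \<one>\<^bsub>R\<^esub> = \<zero>\<^bsub>G\<^esub>"
    using assms by (simp add: R.l_neg del: smult_one flip: smult_r_distr)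
  then show ?thesis using assms by (simp add: G.minus_equality)
qed

lemma submodule_iff: "submodule R E L \<longleftrightarrow> L \<subseteq> carrier G \<and> \<zero>\<^bsub>G\<^esub> \<in> L \<and>
     (\<forall>x\<in>L. \<forall>y\<in>L. x \<oplus>\<^bsub>G\<^esub> y \<in> L) \<and> (\<forall>x\<in>L. \<forall>r\<in>carrier R. x \<cdot> r \<in> L)"
  by (simp add: submodule_def mgroup_simps)

lemma submoduleD:
  assumes "submodule R E L"
  shows "x \<in> L \<Longrightarrow> x \<in> carrier G" "\<zero>\<^bsub>G\<^esub> \<in> L" "x \<in> L \<Longrightarrow> y \<in> L \<Longrightarrow> x \<oplus>\<^bsub>G\<^esub> y \<in> L"
    "x \<in> L \<Longrightarrow> r \<in> carrier R \<Longrightarrow> x \<cdot> r \<in> L"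
    "x \<in> L \<Longrightarrow> \<ominus>\<^bsub>G\<^esub> x \<in> L" "x \<in> L \<Longrightarrow> y \<in> L \<Longrightarrow> x \<ominus>\<^bsub>G\<^esub> y \<in> L"
proof -
  show *: "x \<in> L \<Longrightarrow> x \<in> carrier G" "\<zero>\<^bsub>G\<^esub> \<in> L" "x \<in> L \<Longrightarrow> y \<in> L \<Longrightarrow> x \<oplus>\<^bsub>G\<^esub> y \<in> L"
    "x \<in> L \<Longrightarrow> r \<in> carrier R \<Longrightarrow> x \<cdot> r \<in> L" for x y r
    using assms by (auto simp: submodule_iff)
  show **: "\<ominus>\<^bsub>G\<^esub> x \<in> L" if "x \<in> L" for x
    using *(4)[OF that, of "\<ominus>\<^bsub>R\<^esub> \<one>\<^bsub>R\<^esub>"] smult_minus_one[OF *(1)[OF that]] by simp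
  show "x \<in> L \<Longrightarrow> y \<in> L \<Longrightarrow> x \<ominus>\<^bsub>G\<^esub> y \<in> L" using * ** by (simp add: a_minus_def)
qed

definition cyclic :: "'m \<Rightarrow> 'm set" where "cyclic v = (\<lambda>r. v \<cdot> r) ` carrier R"

definition sumset :: "'m set \<Rightarrow> 'm set \<Rightarrow> 'm set" where
  "sumset A B = {a \<oplus>\<^bsub>G\<^esub> b | a b. a \<in> A \<and> b \<in> B}"

lemma submodule_cyclic: assumes "v \<in> carrier G" shows "submodule R E (cyclic v)"
  unfolding submodule_iff cyclic_def
proof (intro conjI ballI)
  show "\<zero>\<^bsub>G\<^esub> \<in> (\<cdot>) v ` carrier R" using assms by (intro image_eqI[of _ _ "\<zero>\<^bsub>R\<^esub>"]) auto
  show "x \<oplus>\<^bsub>G\<^esub> y \<in> (\<cdot>) v ` carrier R" if "x \<in> (\<cdot>) v ` carrier R" "y \<in> (\<cdot>) v ` carrier R" for x y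
    using that assms by (auto simp flip: smult_r_distr)
  show "x \<cdot> r \<in> (\<cdot>) v ` carrier R" if "x \<in> (\<cdot>) v ` carrier R" "r \<in> carrier R" for x r
    using that assms by (auto simp flip: smult_assoc)
qed (use assms in auto)

lemma cyclic_self: "v \<in> carrier G \<Longrightarrow> v \<in> cyclic v"
  unfolding cyclic_def by (rule image_eqI[of _ _ "\<one>\<^bsub>R\<^esub>"]) auto

lemma submodule_sumset:
  assumes A: "submodule R E A" and B: "submodule R E B"
  shows "submodule R E (sumset A B)" "A \<subseteq> sumset A B" "B \<subseteq> sumset A B"
proof -
  note a = submoduleD[OF A] and b = submoduleD[OF B]
  show "submodule R E (sumset A B)"
    unfolding submodule_iff
  proof (intro conjI ballI)
    show "sumset A B \<subseteq> carrier G" using a b by (auto simp: sumset_def)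
    show "\<zero>\<^bsub>G\<^esub> \<in> sumset A B" using a(2) b(2) unfolding sumset_def by force
    fix x assume "x \<in> sumset A B"
    then obtain p q where x: "p \<in> A" "q \<in> B" "x = p \<oplus>\<^bsub>G\<^esub> q" by (auto simp: sumset_def)
    show "x \<cdot> r \<in> sumset A B" if "r \<in> carrier R" for r
    proof -
      have "x \<cdot> r = p \<cdot> r \<oplus>\<^bsub>G\<^esub> q \<cdot> r" using x a(1) b(1) that by (simp add: smult_l_distr)
      then show ?thesis using x a(4) b(4) that unfolding sumset_def by blast
    qed
    fix y assume "y \<in> sumset A B"
    then obtain p' q' where y: "p' \<in> A" "q' \<in> B" "y = p' \<oplus>\<^bsub>G\<^esub> q'" by (auto simp: sumset_def)
    have "x \<oplus>\<^bsub>G\<^esub> y = (p \<oplus>\<^bsub>G\<^esub> p') \<oplus>\<^bsub>G\<^esub> (q \<oplus>\<^bsub>G\<^esub> q')"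
      using x y a(1) b(1) by (simp add: G.a_ac)
    then show "x \<oplus>\<^bsub>G\<^esub> y \<in> sumset A B" using x y a(3) b(3) unfolding sumset_def by blast
  qed
  show "A \<subseteq> sumset A B"
  proof
    fix x assume "x \<in> A"
    then have "x = x \<oplus>\<^bsub>G\<^esub> \<zero>\<^bsub>G\<^esub>" using a by simp
    then show "x \<in> sumset A B" using \<open>x \<in> A\<close> b(2) unfolding sumset_def by blast
  qed
  show "B \<subseteq> sumset A B"
  proof
    fix x assume "x \<in> B"
    then have "x = \<zero>\<^bsub>G\<^esub> \<oplus>\<^bsub>G\<^esub> x" using b by simp
    then show "x \<in> sumset A B" using \<open>x \<in> B\<close> a(2) unfolding sumset_def by blast
  qed
qed

lemma submodule_Union_chain:
  assumes "C \<noteq> {}" and sub: "\<And>L. L \<in> C \<Longrightarrow> submodule R E L"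
    and chain: "\<And>L L'. L \<in> C \<Longrightarrow> L' \<in> C \<Longrightarrow> L \<subseteq> L' \<or> L' \<subseteq> L"
  shows "submodule R E (\<Union>C)"
  unfolding submodule_iff
proof (intro conjI ballI)
  show "\<Union>C \<subseteq> carrier G" using submoduleD(1)[OF sub] by blast
  show "\<zero>\<^bsub>G\<^esub> \<in> \<Union>C" using assms(1) submoduleD(2)[OF sub] by blast
  show "x \<cdot> r \<in> \<Union>C" if "x \<in> \<Union>C" "r \<in> carrier R" for x r using that submoduleD(4)[OF sub] by blast
  fix x y assume "x \<in> \<Union>C" "y \<in> \<Union>C"
  then obtain L L' where "L \<in> C" "x \<in> L" "L' \<in> C" "y \<in> L'" by blast
  with chain[of L L'] obtain L'' where "L'' \<in> C" "x \<in> L''" "y \<in> L''" by blast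
  then show "x \<oplus>\<^bsub>G\<^esub> y \<in> \<Union>C" using submoduleD(3)[OF sub] by blast
qed

text \<open>Zorn's lemma for submodules with a property \<open>Q\<close> that passes to unions of
  nonempty chains.\<close>

lemma maximal_submodule:
  assumes L0: "submodule R E L0" "Q L0"
    and chain: "\<And>C. C \<noteq> {} \<Longrightarrow> (\<And>L L'. L \<in> C \<Longrightarrow> L' \<in> C \<Longrightarrow> L \<subseteq> L' \<or> L' \<subseteq> L) \<Longrightarrow>
      (\<And>L. L \<in> C \<Longrightarrow> Q L) \<Longrightarrow> Q (\<Union>C)"
  obtains L where "submodule R E L" "Q L"
    "\<And>L'. submodule R E L' \<Longrightarrow> Q L' \<Longrightarrow> L \<subseteq> L' \<Longrightarrow> L' = L"
proof -
  let ?A = "{L. submodule R E L \<and> Q L}"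
  have "\<exists>L\<in>?A. \<forall>X\<in>?A. L \<subseteq> X \<longrightarrow> X = L"
  proof (rule subset_Zorn_nonempty)
    show "?A \<noteq> {}" using L0 by blast
    fix C assume C: "C \<noteq> {}" "subset.chain ?A C"
    then have s: "submodule R E L" "Q L" if "L \<in> C" for L
      using that unfolding subset.chain_def by blast+
    have lin: "L \<subseteq> L' \<or> L' \<subseteq> L" if "L \<in> C" "L' \<in> C" for L L'
      using C(2) that unfolding subset.chain_def by blast
    show "\<Union>C \<in> ?A"
      using submodule_Union_chain[OF C(1) s(1) lin] chain[OF C(1) lin s(2)] by blast
  qed
  then show thesis using that by blast
qed

section \<open>The endomorphism ring\<close>

lemma endo_iff: "f \<in> carrier S \<longleftrightarrow> f \<in> extensional (carrier G) \<and>
    (\<forall>x\<in>carrier G. f x \<in> carrier G) \<and>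
    (\<forall>x\<in>carrier G. \<forall>y\<in>carrier G. f (x \<oplus>\<^bsub>G\<^esub> y) = f x \<oplus>\<^bsub>G\<^esub> f y) \<and>
    (\<forall>x\<in>carrier G. \<forall>r\<in>carrier R. f (x \<cdot> r) = f x \<cdot> r)"
  by (simp add: endo_ring_def rhom_def mgroup_simps)

lemma endoI:
  assumes "f \<in> extensional (carrier G)" "\<And>x. x \<in> carrier G \<Longrightarrow> f x \<in> carrier G"
    "\<And>x y. x \<in> carrier G \<Longrightarrow> y \<in> carrier G \<Longrightarrow> f (x \<oplus>\<^bsub>G\<^esub> y) = f x \<oplus>\<^bsub>G\<^esub> f y"
    "\<And>x r. x \<in> carrier G \<Longrightarrow> r \<in> carrier R \<Longrightarrow> f (x \<cdot> r) = f x \<cdot> r"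
  shows "f \<in> carrier S"
  using assms unfolding endo_iff by blast

lemma endo_eqI:
  assumes "f \<in> carrier S" "g \<in> carrier S" "\<And>x. x \<in> carrier G \<Longrightarrow> f x = g x"
  shows "f = g"
  using assms extensionalityI[of f "carrier G" g] by (auto simp: endo_iff)

lemma endo_apply [simp]:
  assumes "x \<in> carrier G"
  shows "(f \<otimes>\<^bsub>S\<^esub> g) x = f (g x)" "\<one>\<^bsub>S\<^esub> x = x" "\<zero>\<^bsub>S\<^esub> x = \<zero>\<^bsub>G\<^esub>" "(f \<oplus>\<^bsub>S\<^esub> g) x = f x \<oplus>\<^bsub>G\<^esub> g x"
  using assms by (simp_all add: endo_ring_def mgroup_simps)

lemma endo_closed [simp]:
  "f \<in> carrier S \<Longrightarrow> x \<in> carrier G \<Longrightarrow> f x \<in> carrier G"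
  by (simp add: endo_iff)

lemma endo_add: "f \<in> carrier S \<Longrightarrow> x \<in> carrier G \<Longrightarrow> y \<in> carrier G \<Longrightarrow> f (x \<oplus>\<^bsub>G\<^esub> y) = f x \<oplus>\<^bsub>G\<^esub> f y"
  by (simp add: endo_iff)

lemma endo_smult: "f \<in> carrier S \<Longrightarrow> x \<in> carrier G \<Longrightarrow> r \<in> carrier R \<Longrightarrow> f (x \<cdot> r) = f x \<cdot> r"
  by (simp add: endo_iff)

lemma endo_ops_ext [simp]:
  "f \<otimes>\<^bsub>S\<^esub> g \<in> extensional (carrier G)" "f \<oplus>\<^bsub>S\<^esub> g \<in> extensional (carrier G)"
  "\<one>\<^bsub>S\<^esub> \<in> extensional (carrier G)" "\<zero>\<^bsub>S\<^esub> \<in> extensional (carrier G)"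
  by (simp_all add: endo_ring_def mgroup_simps)

sublocale S: ring S
proof (rule ringI)
  have mult: "f \<otimes>\<^bsub>S\<^esub> g \<in> carrier S" if "f \<in> carrier S" "g \<in> carrier S" for f g
    using that by (intro endoI) (simp_all add: endo_add endo_smult)
  have add: "f \<oplus>\<^bsub>S\<^esub> g \<in> carrier S" if "f \<in> carrier S" "g \<in> carrier S" for f g
    using that by (intro endoI) (simp_all add: endo_add endo_smult smult_l_distr G.a_ac)
  have one: "\<one>\<^bsub>S\<^esub> \<in> carrier S" and zero: "\<zero>\<^bsub>S\<^esub> \<in> carrier S"
    by (intro endoI; simp)+
  show "abelian_group S"
  proof (rule abelian_groupI)
    fix f assume f: "f \<in> carrier S"
    let ?g = "\<lambda>x\<in>carrier G. \<ominus>\<^bsub>G\<^esub> (f x)"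
    have "\<ominus>\<^bsub>G\<^esub> (x \<cdot> r) = (\<ominus>\<^bsub>G\<^esub> x) \<cdot> r" if "x \<in> carrier G" "r \<in> carrier R" for x r
    proof -
      have "(\<ominus>\<^bsub>G\<^esub> x) \<cdot> r \<oplus>\<^bsub>G\<^esub> x \<cdot> r = \<zero>\<^bsub>G\<^esub>"
        using that by (simp add: G.l_neg flip: smult_l_distr)
      then show ?thesis using that by (simp add: G.minus_equality)
    qed
    then have g: "?g \<in> carrier S"
      using f by (intro endoI) (simp_all add: endo_add endo_smult G.minus_add)
    moreover have "?g \<oplus>\<^bsub>S\<^esub> f = \<zero>\<^bsub>S\<^esub>"
      using f g add zero by (intro endo_eqI) (auto simp: G.l_neg)
    ultimately show "\<exists>g\<in>carrier S. g \<oplus>\<^bsub>S\<^esub> f = \<zero>\<^bsub>S\<^esub>" by blast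
  next
    show "f \<oplus>\<^bsub>S\<^esub> g \<oplus>\<^bsub>S\<^esub> h = f \<oplus>\<^bsub>S\<^esub> (g \<oplus>\<^bsub>S\<^esub> h)" if "f \<in> carrier S" "g \<in> carrier S" "h \<in> carrier S" for f g h
      using that add by (intro endo_eqI) (auto simp: G.a_assoc)
    show "f \<oplus>\<^bsub>S\<^esub> g = g \<oplus>\<^bsub>S\<^esub> f" if "f \<in> carrier S" "g \<in> carrier S" for f g
      using that add by (intro endo_eqI) (auto simp: G.a_comm)
    show "\<zero>\<^bsub>S\<^esub> \<oplus>\<^bsub>S\<^esub> f = f" if "f \<in> carrier S" for f
      using that add zero by (intro endo_eqI) auto
  qed (use add zero in auto)
  show "Group.monoid S"
  proof (rule monoidI)
    show "f \<otimes>\<^bsub>S\<^esub> g \<otimes>\<^bsub>S\<^esub> h = f \<otimes>\<^bsub>S\<^esub> (g \<otimes>\<^bsub>S\<^esub> h)" if "f \<in> carrier S" "g \<in> carrier S" "h \<in> carrier S" for f g h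
      using that mult by (intro endo_eqI) auto
    show "\<one>\<^bsub>S\<^esub> \<otimes>\<^bsub>S\<^esub> f = f" "f \<otimes>\<^bsub>S\<^esub> \<one>\<^bsub>S\<^esub> = f" if "f \<in> carrier S" for f
      using that mult one by (intro endo_eqI; auto)+
  qed (use mult one in auto)
  fix f g h assume fgh: "f \<in> carrier S" "g \<in> carrier S" "h \<in> carrier S"
  show "(f \<oplus>\<^bsub>S\<^esub> g) \<otimes>\<^bsub>S\<^esub> h = f \<otimes>\<^bsub>S\<^esub> h \<oplus>\<^bsub>S\<^esub> g \<otimes>\<^bsub>S\<^esub> h" "h \<otimes>\<^bsub>S\<^esub> (f \<oplus>\<^bsub>S\<^esub> g) = h \<otimes>\<^bsub>S\<^esub> f \<oplus>\<^bsub>S\<^esub> h \<otimes>\<^bsub>S\<^esub> g"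
    using fgh mult add by (intro endo_eqI; auto simp: endo_add)+
qed

lemma endo_zero [simp]: assumes "f \<in> carrier S" shows "f \<zero>\<^bsub>G\<^esub> = \<zero>\<^bsub>G\<^esub>"
  using endo_smult[OF assms, of "\<zero>\<^bsub>G\<^esub>" "\<zero>\<^bsub>R\<^esub>"] assms by simp

lemma endo_uminus: assumes "f \<in> carrier S" "x \<in> carrier G" shows "f (\<ominus>\<^bsub>G\<^esub> x) = \<ominus>\<^bsub>G\<^esub> f x"
  using endo_smult[OF assms, of "\<ominus>\<^bsub>R\<^esub> \<one>\<^bsub>R\<^esub>"] assms by (simp add: smult_minus_one)

lemma endo_minus: "f \<in> carrier S \<Longrightarrow> x \<in> carrier G \<Longrightarrow> y \<in> carrier G \<Longrightarrow> f (x \<ominus>\<^bsub>G\<^esub> y) = f x \<ominus>\<^bsub>G\<^esub> f y"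
  by (simp add: a_minus_def endo_add endo_uminus)

lemma uminus_apply [simp]:
  assumes "f \<in> carrier S" "x \<in> carrier G" shows "(\<ominus>\<^bsub>S\<^esub> f) x = \<ominus>\<^bsub>G\<^esub> f x"
proof -
  have "(\<ominus>\<^bsub>S\<^esub> f) x \<oplus>\<^bsub>G\<^esub> f x = (\<ominus>\<^bsub>S\<^esub> f \<oplus>\<^bsub>S\<^esub> f) x" using assms by simp
  also have "\<dots> = \<zero>\<^bsub>G\<^esub>" using assms by (simp add: S.l_neg del: endo_apply(4))
  finally show ?thesis using assms by (simp add: G.minus_equality)
qed

lemma minus_apply [simp]:
  "f \<in> carrier S \<Longrightarrow> g \<in> carrier S \<Longrightarrow> x \<in> carrier G \<Longrightarrow> (f \<ominus>\<^bsub>S\<^esub> g) x = f x \<ominus>\<^bsub>G\<^esub> g x"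
  by (simp add: a_minus_def)

lemma submodule_image:
  assumes f: "f \<in> carrier S" and L: "submodule R E L"
  shows "submodule R E (f ` L)"
  unfolding submodule_iff
proof (intro conjI ballI)
  note l = submoduleD[OF L]
  show "f ` L \<subseteq> carrier G" using f l by auto
  show "\<zero>\<^bsub>G\<^esub> \<in> f ` L" using l(2) f by (metis endo_zero imageI)
  show "x \<oplus>\<^bsub>G\<^esub> y \<in> f ` L" if "x \<in> f ` L" "y \<in> f ` L" for x y
    using that f l by (auto simp flip: endo_add)
  show "x \<cdot> r \<in> f ` L" if "x \<in> f ` L" "r \<in> carrier R" for x r
    using that f l by (auto simp flip: endo_smult)
qed

lemma minus_eq_zeroD:
  assumes "x \<ominus>\<^bsub>G\<^esub> y = \<zero>\<^bsub>G\<^esub>" "x \<in> carrier G" "y \<in> carrier G" shows "x = y"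
proof -
  have "x = (x \<ominus>\<^bsub>G\<^esub> y) \<oplus>\<^bsub>G\<^esub> y" using assms(2,3) by (simp add: a_minus_def G.a_assoc G.l_neg)
  then show ?thesis using assms by simp
qed

section \<open>Fixed submodules, essential submodules and graphs of partial homomorphisms\<close>

definition fixed :: "('m \<Rightarrow> 'm) \<Rightarrow> 'm set" where "fixed e = {x \<in> carrier G. e x = x}"

text \<open>Elementwise essentiality: every nonzero element of \<open>C\<close> has a nonzero
  multiple in \<open>K\<close>. This form applies directly to kernels and images.\<close>

definition essential_in :: "'m set \<Rightarrow> 'm set \<Rightarrow> bool" where
  "essential_in K C \<longleftrightarrow> (\<forall>v\<in>C. v \<noteq> \<zero>\<^bsub>G\<^esub> \<longrightarrow> (\<exists>r\<in>carrier R. v \<cdot> r \<in> K \<and> v \<cdot> r \<noteq> \<zero>\<^bsub>G\<^esub>))"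

text \<open>The nonempty relations of this kind are the graphs of homomorphisms from submodules of
  \<open>E\<close> to \<open>E\<close>. The last clause yields single-valuedness, since differences
  of pairs are again pairs. Inclusion of graphs is extension of maps, which suits Zorn's
  lemma.\<close>

definition lin_graph :: "('m \<times> 'm) set \<Rightarrow> bool" where
  "lin_graph \<Gamma> \<longleftrightarrow> \<Gamma> \<subseteq> carrier G \<times> carrier G \<and>
     (\<forall>x y x' y'. (x, y) \<in> \<Gamma> \<and> (x', y') \<in> \<Gamma> \<longrightarrow> (x \<oplus>\<^bsub>G\<^esub> x', y \<oplus>\<^bsub>G\<^esub> y') \<in> \<Gamma>) \<and>
     (\<forall>x y. \<forall>r\<in>carrier R. (x, y) \<in> \<Gamma> \<longrightarrow> (x \<cdot> r, y \<cdot> r) \<in> \<Gamma>) \<and>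
     (\<forall>y. (\<zero>\<^bsub>G\<^esub>, y) \<in> \<Gamma> \<longrightarrow> y = \<zero>\<^bsub>G\<^esub>)"

lemma lin_graphD:
  assumes "lin_graph \<Gamma>"
  shows "(x, y) \<in> \<Gamma> \<Longrightarrow> x \<in> carrier G" "(x, y) \<in> \<Gamma> \<Longrightarrow> y \<in> carrier G"
    "(x, y) \<in> \<Gamma> \<Longrightarrow> (x', y') \<in> \<Gamma> \<Longrightarrow> (x \<oplus>\<^bsub>G\<^esub> x', y \<oplus>\<^bsub>G\<^esub> y') \<in> \<Gamma>"
    "(x, y) \<in> \<Gamma> \<Longrightarrow> r \<in> carrier R \<Longrightarrow> (x \<cdot> r, y \<cdot> r) \<in> \<Gamma>"
    "(\<zero>\<^bsub>G\<^esub>, y) \<in> \<Gamma> \<Longrightarrow> y = \<zero>\<^bsub>G\<^esub>"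
  using assms unfolding lin_graph_def by blast+

lemma lin_graph_unique:
  assumes \<Gamma>: "lin_graph \<Gamma>" and xy: "(x, y) \<in> \<Gamma>" "(x, y') \<in> \<Gamma>"
  shows "y = y'"
proof -
  note l = lin_graphD[OF \<Gamma>]
  have c: "x \<in> carrier G" "y \<in> carrier G" "y' \<in> carrier G" using xy l by blast+
  have "(\<ominus>\<^bsub>G\<^esub> x, \<ominus>\<^bsub>G\<^esub> y') \<in> \<Gamma>"
    using l(4)[OF xy(2), of "\<ominus>\<^bsub>R\<^esub> \<one>\<^bsub>R\<^esub>"] c by (simp add: smult_minus_one)
  then have "(x \<oplus>\<^bsub>G\<^esub> (\<ominus>\<^bsub>G\<^esub> x), y \<oplus>\<^bsub>G\<^esub> (\<ominus>\<^bsub>G\<^esub> y')) \<in> \<Gamma>" using l(3) xy(1) by blast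
  then have "y \<ominus>\<^bsub>G\<^esub> y' = \<zero>\<^bsub>G\<^esub>" using l(5) c by (simp add: G.r_neg a_minus_def)
  then show ?thesis using c minus_eq_zeroD by blast
qed

text \<open>Each closure condition involves at most two pairs, and two pairs from the union of a
  chain already lie in a common member.\<close>

lemma maximal_lin_graph:
  assumes "lin_graph F"
  obtains \<Gamma> where "lin_graph \<Gamma>" "F \<subseteq> \<Gamma>" "\<And>\<Gamma>'. lin_graph \<Gamma>' \<Longrightarrow> \<Gamma> \<subseteq> \<Gamma>' \<Longrightarrow> \<Gamma>' = \<Gamma>"
proof -
  let ?A = "{\<Gamma>. lin_graph \<Gamma> \<and> F \<subseteq> \<Gamma>}"
  have "\<exists>L\<in>?A. \<forall>X\<in>?A. L \<subseteq> X \<longrightarrow> X = L"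
  proof (rule subset_Zorn_nonempty)
    show "?A \<noteq> {}" using assms by blast
    fix C assume C: "C \<noteq> {}" "subset.chain ?A C"
    then have s: "lin_graph L" "F \<subseteq> L" if "L \<in> C" for L
      using that unfolding subset.chain_def by blast+
    have lin: "L \<subseteq> L' \<or> L' \<subseteq> L" if "L \<in> C" "L' \<in> C" for L L'
      using C(2) that unfolding subset.chain_def by blast
    have "lin_graph (\<Union>C)"
      unfolding lin_graph_def
    proof (intro conjI allI ballI impI)
      show "\<Union>C \<subseteq> carrier G \<times> carrier G"
      proof (rule Union_least)
        show "L \<subseteq> carrier G \<times> carrier G" if "L \<in> C" for L
          using s(1)[OF that] by (simp add: lin_graph_def)
      qed
      show "(x \<cdot> r, y \<cdot> r) \<in> \<Union>C" if r: "r \<in> carrier R" "(x, y) \<in> \<Union>C" for r x y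

      proof -
        obtain L where L: "L \<in> C" "(x, y) \<in> L" using r(2) by blast
        then show ?thesis using lin_graphD(4)[OF s(1)[OF L(1)] L(2) r(1)] by blast
      qed
      show "y = \<zero>\<^bsub>G\<^esub>" if "(\<zero>\<^bsub>G\<^esub>, y) \<in> \<Union>C" for y using that lin_graphD(5)[OF s(1)] by blast
      fix x y x' y' assume "(x, y) \<in> \<Union>C \<and> (x', y') \<in> \<Union>C"
      then obtain L L' where L: "L \<in> C" "(x, y) \<in> L" "L' \<in> C" "(x', y') \<in> L'" by blast
      then obtain L'' where L'': "L'' \<in> C" "(x, y) \<in> L''" "(x', y') \<in> L''"
        using lin[OF L(1,3)] by auto
      show "(x \<oplus>\<^bsub>G\<^esub> x', y \<oplus>\<^bsub>G\<^esub> y') \<in> \<Union>C"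
        using lin_graphD(3)[OF s(1)[OF L''(1)] L''(2,3)] L''(1) by blast
    qed
    moreover obtain L where "L \<in> C" using C(1) by auto
    then have "F \<subseteq> \<Union>C" using s(2)[of L] by auto
    ultimately show "\<Union>C \<in> ?A" by simp
  qed
  then obtain \<Gamma> where "lin_graph \<Gamma>" "F \<subseteq> \<Gamma>" "\<forall>X\<in>?A. \<Gamma> \<subseteq> X \<longrightarrow> X = \<Gamma>" by auto
  then show thesis by (intro that[of \<Gamma>]) auto
qed

end

section \<open>Injective modules\<close>

locale injective_rmod = rmod +
  assumes injective: "injective_module R E"
begin

section \<open>Extension of homomorphisms, and summands that are hulls\<close>

lemma baer:
  assumes "right_ideal R I" "\<And>a. a \<in> I \<Longrightarrow> h a \<in> carrier G"
    "\<And>a b. a \<in> I \<Longrightarrow> b \<in> I \<Longrightarrow> h (a \<oplus>\<^bsub>R\<^esub> b) = h a \<oplus>\<^bsub>G\<^esub> h b"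
    "\<And>a r. a \<in> I \<Longrightarrow> r \<in> carrier R \<Longrightarrow> h (a \<otimes>\<^bsub>R\<^esub> r) = h a \<cdot> r"
  obtains e where "e \<in> carrier G" "\<And>a. a \<in> I \<Longrightarrow> h a = e \<cdot> a"
proof -
  have "\<exists>e\<in>carrier G. \<forall>a\<in>I. h a = e \<cdot> a"
    using injective[unfolded injective_module_def mgroup_simps[symmetric], THEN spec, THEN spec, THEN mp, of I h]
      assms by simp
  then show thesis using that by blast
qed

text \<open>This derives the full extension property from Baer's criterion: a maximal partial
  extension must be total, because any further element \<open>x\<close> can be adjoined to its
  domain.\<close>

lemma extend_hom:
  assumes L: "submodule R E L"
    and f: "\<And>x. x \<in> L \<Longrightarrow> f x \<in> carrier G"
      "\<And>x y. x \<in> L \<Longrightarrow> y \<in> L \<Longrightarrow> f (x \<oplus>\<^bsub>G\<^esub> y) = f x \<oplus>\<^bsub>G\<^esub> f y"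
      "\<And>x r. x \<in> L \<Longrightarrow> r \<in> carrier R \<Longrightarrow> f (x \<cdot> r) = f x \<cdot> r"
  obtains s where "s \<in> carrier S" "\<And>x. x \<in> L \<Longrightarrow> s x = f x"
proof -
  note l = submoduleD[OF L]
  have f0: "f \<zero>\<^bsub>G\<^esub> = \<zero>\<^bsub>G\<^esub>" using f(3)[OF l(2) R.zero_closed] f(1)[OF l(2)] by simp
  define F where "F = {(x, f x) | x. x \<in> L}"
  have "lin_graph F"
    unfolding lin_graph_def F_def using l(1-4) f f0 by auto
  then obtain \<Gamma> where \<Gamma>: "lin_graph \<Gamma>" "F \<subseteq> \<Gamma>"
    and max: "\<And>\<Gamma>'. lin_graph \<Gamma>' \<Longrightarrow> \<Gamma> \<subseteq> \<Gamma>' \<Longrightarrow> \<Gamma>' = \<Gamma>"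
    using maximal_lin_graph by metis
  note g = lin_graphD[OF \<Gamma>(1)] and uniq = lin_graph_unique[OF \<Gamma>(1)]
  have zero: "(\<zero>\<^bsub>G\<^esub>, \<zero>\<^bsub>G\<^esub>) \<in> \<Gamma>" using \<Gamma>(2) l(2) f0 unfolding F_def by force
  have total: "\<exists>y. (x, y) \<in> \<Gamma>" if x: "x \<in> carrier G" for x
  proof -
    \<comment> \<open>\<open>?I\<close> collects the scalars that move \<open>x\<close> into the
      domain of \<open>\<Gamma>\<close>, and \<open>h\<close> records the values there. Baer's
      criterion turns \<open>h\<close> into multiplication by an element \<open>e\<close>, the value
      to be assigned to \<open>x\<close>.\<close>
    let ?I = "{r \<in> carrier R. \<exists>y. (x \<cdot> r, y) \<in> \<Gamma>}"
    define h where "h r = (THE y. (x \<cdot> r, y) \<in> \<Gamma>)" for r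
    have h: "h r = y" if "(x \<cdot> r, y) \<in> \<Gamma>" for r y
      unfolding h_def using that uniq by blast
    have hI: "(x \<cdot> r, h r) \<in> \<Gamma>" if "r \<in> ?I" for r using that h by auto
    have sum: "(x \<cdot> (a \<oplus>\<^bsub>R\<^esub> b), h a \<oplus>\<^bsub>G\<^esub> h b) \<in> \<Gamma>" if "a \<in> ?I" "b \<in> ?I" for a b
      using g(3)[OF hI[OF that(1)] hI[OF that(2)]] that x by (simp add: smult_r_distr)
    have prod: "(x \<cdot> (a \<otimes>\<^bsub>R\<^esub> r), h a \<cdot> r) \<in> \<Gamma>" if "a \<in> ?I" "r \<in> carrier R" for a r
      using g(4)[OF hI[OF that(1)] that(2)] that x by (simp add: smult_assoc)
    have I: "right_ideal R ?I"
      unfolding right_ideal_def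
    proof (intro conjI ballI)
      show "\<zero>\<^bsub>R\<^esub> \<in> ?I" using zero x by auto
      show "a \<oplus>\<^bsub>R\<^esub> b \<in> ?I" if "a \<in> ?I" "b \<in> ?I" for a b
        using sum[OF that] that by blast
      show "a \<otimes>\<^bsub>R\<^esub> r \<in> ?I" if "a \<in> ?I" "r \<in> carrier R" for a r
        using prod[OF that] that by blast
    qed blast
    obtain e where e: "e \<in> carrier G" "\<And>a. a \<in> ?I \<Longrightarrow> h a = e \<cdot> a"
    proof (rule baer[OF I, of h])
      show "h a \<in> carrier G" if "a \<in> ?I" for a using g(2)[OF hI[OF that]] .
      show "h (a \<oplus>\<^bsub>R\<^esub> b) = h a \<oplus>\<^bsub>G\<^esub> h b" if "a \<in> ?I" "b \<in> ?I" for a b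
        using h[OF sum[OF that]] .
      show "h (a \<otimes>\<^bsub>R\<^esub> r) = h a \<cdot> r" if "a \<in> ?I" "r \<in> carrier R" for a r
        using h[OF prod[OF that]] .
    qed blast
    define \<Gamma>' where "\<Gamma>' = {(a \<oplus>\<^bsub>G\<^esub> x \<cdot> r, b \<oplus>\<^bsub>G\<^esub> e \<cdot> r) | a b r. (a, b) \<in> \<Gamma> \<and> r \<in> carrier R}"
    have "lin_graph \<Gamma>'"
      unfolding lin_graph_def
    proof (intro conjI allI ballI impI)
      show "\<Gamma>' \<subseteq> carrier G \<times> carrier G" using g(1,2) x e(1) by (auto simp: \<Gamma>'_def)
    next
      fix p q p' q' assume "(p, q) \<in> \<Gamma>' \<and> (p', q') \<in> \<Gamma>'"
      then obtain a b r a' b' r' where 1: "(a, b) \<in> \<Gamma>" "r \<in> carrier R" "p = a \<oplus>\<^bsub>G\<^esub> x \<cdot> r" "q = b \<oplus>\<^bsub>G\<^esub> e \<cdot> r"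
        and 2: "(a', b') \<in> \<Gamma>" "r' \<in> carrier R" "p' = a' \<oplus>\<^bsub>G\<^esub> x \<cdot> r'" "q' = b' \<oplus>\<^bsub>G\<^esub> e \<cdot> r'"
        unfolding \<Gamma>'_def by blast
      have "p \<oplus>\<^bsub>G\<^esub> p' = (a \<oplus>\<^bsub>G\<^esub> a') \<oplus>\<^bsub>G\<^esub> x \<cdot> (r \<oplus>\<^bsub>R\<^esub> r')" "q \<oplus>\<^bsub>G\<^esub> q' = (b \<oplus>\<^bsub>G\<^esub> b') \<oplus>\<^bsub>G\<^esub> e \<cdot> (r \<oplus>\<^bsub>R\<^esub> r')"
        using 1 2 g(1,2) x e(1) by (simp_all add: smult_r_distr G.a_ac)
      moreover have "(a \<oplus>\<^bsub>G\<^esub> a', b \<oplus>\<^bsub>G\<^esub> b') \<in> \<Gamma>" using g(3) 1 2 by blast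
      ultimately show "(p \<oplus>\<^bsub>G\<^esub> p', q \<oplus>\<^bsub>G\<^esub> q') \<in> \<Gamma>'" using 1(2) 2(2) unfolding \<Gamma>'_def by blast
    next
      fix p q s assume s: "s \<in> carrier R" and "(p, q) \<in> \<Gamma>'"
      then obtain a b r where 1: "(a, b) \<in> \<Gamma>" "r \<in> carrier R" "p = a \<oplus>\<^bsub>G\<^esub> x \<cdot> r" "q = b \<oplus>\<^bsub>G\<^esub> e \<cdot> r"
        unfolding \<Gamma>'_def by blast
      have "p \<cdot> s = a \<cdot> s \<oplus>\<^bsub>G\<^esub> x \<cdot> (r \<otimes>\<^bsub>R\<^esub> s)" "q \<cdot> s = b \<cdot> s \<oplus>\<^bsub>G\<^esub> e \<cdot> (r \<otimes>\<^bsub>R\<^esub> s)"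
        using 1 s g(1,2) x e(1) by (simp_all add: smult_l_distr smult_assoc)
      moreover have "(a \<cdot> s, b \<cdot> s) \<in> \<Gamma>" using g(4) 1 s by blast
      moreover have "r \<otimes>\<^bsub>R\<^esub> s \<in> carrier R" using 1 s by blast
      ultimately show "(p \<cdot> s, q \<cdot> s) \<in> \<Gamma>'" unfolding \<Gamma>'_def by blast
    next
      \<comment> \<open>Single-valuedness: if \<open>a + x r = 0\<close>, then
        \<open>\<Gamma>\<close> relates \<open>x r\<close> to \<open>-b\<close>, so
        \<open>-b = h r = e r\<close> and the new value \<open>b + e r\<close> vanishes.\<close>
      fix q assume "(\<zero>\<^bsub>G\<^esub>, q) \<in> \<Gamma>'"
      then obtain a b r where 1: "(a, b) \<in> \<Gamma>" "r \<in> carrier R" "\<zero>\<^bsub>G\<^esub> = a \<oplus>\<^bsub>G\<^esub> x \<cdot> r" "q = b \<oplus>\<^bsub>G\<^esub> e \<cdot> r"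
        unfolding \<Gamma>'_def by blast
      have c: "a \<in> carrier G" "b \<in> carrier G" using g 1 by blast+
      have "x \<cdot> r = \<ominus>\<^bsub>G\<^esub> a"
        using G.minus_equality[of "x \<cdot> r" a] 1(2,3) c x by (simp add: G.a_comm)
      then have xr: "(x \<cdot> r, \<ominus>\<^bsub>G\<^esub> b) \<in> \<Gamma>"
        using g(4)[OF 1(1), of "\<ominus>\<^bsub>R\<^esub> \<one>\<^bsub>R\<^esub>"] c by (simp add: smult_minus_one)
      then have "r \<in> ?I" using 1 by blast
      then have "\<ominus>\<^bsub>G\<^esub> b = e \<cdot> r" using h[OF xr] e(2) by simp
      then show "q = \<zero>\<^bsub>G\<^esub>" using 1(4) c by (metis G.r_neg)
    qed
    moreover have "\<Gamma> \<subseteq> \<Gamma>'"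
    proof clarify
      fix a b assume ab: "(a, b) \<in> \<Gamma>"
      have "(a, b) = (a \<oplus>\<^bsub>G\<^esub> x \<cdot> \<zero>\<^bsub>R\<^esub>, b \<oplus>\<^bsub>G\<^esub> e \<cdot> \<zero>\<^bsub>R\<^esub>)" using g(1,2)[OF ab] x e(1) by simp
      then show "(a, b) \<in> \<Gamma>'" using ab R.zero_closed unfolding \<Gamma>'_def by blast
    qed
    ultimately have "\<Gamma>' = \<Gamma>" by (rule max)
    moreover have "(x, e) = (\<zero>\<^bsub>G\<^esub> \<oplus>\<^bsub>G\<^esub> x \<cdot> \<one>\<^bsub>R\<^esub>, \<zero>\<^bsub>G\<^esub> \<oplus>\<^bsub>G\<^esub> e \<cdot> \<one>\<^bsub>R\<^esub>)" using x e(1) by simp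
    then have "(x, e) \<in> \<Gamma>'" using zero R.one_closed unfolding \<Gamma>'_def by blast
    ultimately show ?thesis by blast
  qed
  define s where "s = (\<lambda>x\<in>carrier G. THE y. (x, y) \<in> \<Gamma>)"
  have s: "s x = y" if "(x, y) \<in> \<Gamma>" for x y
    unfolding s_def using that uniq g(1)[OF that] by auto
  have sg: "(x, s x) \<in> \<Gamma>" if "x \<in> carrier G" for x using total[OF that] s by blast
  have "s \<in> carrier S"
  proof (rule endoI)
    show "s \<in> extensional (carrier G)" by (simp add: s_def)
    show "s x \<in> carrier G" if "x \<in> carrier G" for x using g(2)[OF sg[OF that]] .
    show "s (x \<oplus>\<^bsub>G\<^esub> y) = s x \<oplus>\<^bsub>G\<^esub> s y" if "x \<in> carrier G" "y \<in> carrier G" for x y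
      using s[OF g(3)[OF sg[OF that(1)] sg[OF that(2)]]] .
    show "s (x \<cdot> r) = s x \<cdot> r" if "x \<in> carrier G" "r \<in> carrier R" for x r
      using s[OF g(4)[OF sg[OF that(1)] that(2)]] .
  qed
  moreover have "s x = f x" if "x \<in> L" for x
    using s[of x "f x"] \<Gamma>(2) that unfolding F_def by blast
  ultimately show thesis by (rule that)
qed

text \<open>The inverse of \<open>y\<close> on \<open>y(L)\<close> is linear, so injectivity of
  \<open>E\<close> extends it to all of \<open>E\<close>.\<close>

lemma extend_inverse:
  assumes y: "y \<in> carrier S" and L: "submodule R E L"
    and inj: "\<And>x. x \<in> L \<Longrightarrow> y x = \<zero>\<^bsub>G\<^esub> \<Longrightarrow> x = \<zero>\<^bsub>G\<^esub>"
  obtains t where "t \<in> carrier S" "\<And>x. x \<in> L \<Longrightarrow> t (y x) = x"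
proof -
  note l = submoduleD[OF L] and goal = that
  have "inj_on y L"
  proof (rule inj_onI)
    fix a b assume ab: "a \<in> L" "b \<in> L" "y a = y b"
    have c: "a \<in> carrier G" "b \<in> carrier G" using ab l(1) by blast+
    have "y (a \<ominus>\<^bsub>G\<^esub> b) = \<zero>\<^bsub>G\<^esub>"
      using ab(3) endo_minus[OF y c] endo_closed[OF y c(2)] by (simp add: a_minus_def G.r_neg)
    then have "a \<ominus>\<^bsub>G\<^esub> b = \<zero>\<^bsub>G\<^esub>" by (rule inj[OF l(6)[OF ab(1,2)]])
    then show "a = b" using minus_eq_zeroD c by blast
  qed
  then have inv: "inv_into L y (y x) = x" if "x \<in> L" for x using that by simp
  show thesis
  proof (rule extend_hom[OF submodule_image[OF y L], of "inv_into L y"])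
    show "inv_into L y x \<in> carrier G" if "x \<in> y ` L" for x using that inv l(1) by auto
    show "inv_into L y (p \<oplus>\<^bsub>G\<^esub> q) = inv_into L y p \<oplus>\<^bsub>G\<^esub> inv_into L y q" if pq: "p \<in> y ` L" "q \<in> y ` L" for p q
    proof -
      obtain a b where ab: "a \<in> L" "b \<in> L" "p = y a" "q = y b" using pq by blast
      then have "p \<oplus>\<^bsub>G\<^esub> q = y (a \<oplus>\<^bsub>G\<^esub> b)" using y l(1) by (simp add: endo_add)
      then show ?thesis using ab l(3) inv by simp
    qed
    show "inv_into L y (p \<cdot> r) = inv_into L y p \<cdot> r" if p: "p \<in> y ` L" "r \<in> carrier R" for p r
    proof -
      obtain a where a: "a \<in> L" "p = y a" using p by blast
      then have "p \<cdot> r = y (a \<cdot> r)" using y l(1) p(2) by (simp add: endo_smult)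
      then show ?thesis using a p(2) l(4) inv by simp
    qed
    show thesis if s: "s \<in> carrier S" "\<And>x. x \<in> y ` L \<Longrightarrow> s x = inv_into L y x" for s
      using s inv by (intro goal[of s]) auto
  qed
qed

text \<open>The sum \<open>A + B\<close> is direct, and its projection onto \<open>A\<close> along
  \<open>B\<close> extends to \<open>E\<close>. The extension is controlled only on
  \<open>A + B\<close>, so it need not be idempotent.\<close>

lemma projection:
  assumes A: "submodule R E A" and B: "submodule R E B" and AB: "A \<inter> B \<subseteq> {\<zero>\<^bsub>G\<^esub>}"
  obtains e where "e \<in> carrier S" "\<And>a. a \<in> A \<Longrightarrow> e a = a" "\<And>b. b \<in> B \<Longrightarrow> e b = \<zero>\<^bsub>G\<^esub>"
proof -
  note a = submoduleD[OF A] and b = submoduleD[OF B] and goal = that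
  have uniq: "p = p'" if p: "p \<in> A" "q \<in> B" "p' \<in> A" "q' \<in> B" and eq: "p \<oplus>\<^bsub>G\<^esub> q = p' \<oplus>\<^bsub>G\<^esub> q'" for p q p' q'
  proof -
    have c: "p \<in> carrier G" "p' \<in> carrier G" "q \<in> carrier G" "q' \<in> carrier G"
      using p a(1) b(1) by blast+
    have "p \<ominus>\<^bsub>G\<^esub> p' = (\<ominus>\<^bsub>G\<^esub> p') \<oplus>\<^bsub>G\<^esub> ((p \<oplus>\<^bsub>G\<^esub> q) \<ominus>\<^bsub>G\<^esub> q)"
      using c by (simp add: a_minus_def G.a_assoc G.r_neg2 G.a_comm[of p])
    also have "\<dots> = q' \<ominus>\<^bsub>G\<^esub> q" unfolding eq using c by (simp add: a_minus_def G.a_assoc G.r_neg1)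
    finally have "p \<ominus>\<^bsub>G\<^esub> p' \<in> B" using b(6)[OF p(4,2)] by simp
    then have "p \<ominus>\<^bsub>G\<^esub> p' = \<zero>\<^bsub>G\<^esub>" using a(6)[OF p(1,3)] AB by blast
    then show ?thesis using minus_eq_zeroD c by blast
  qed
  define f where "f x = (THE p. p \<in> A \<and> (\<exists>q\<in>B. x = p \<oplus>\<^bsub>G\<^esub> q))" for x
  have f: "f (p \<oplus>\<^bsub>G\<^esub> q) = p" if "p \<in> A" "q \<in> B" for p q
    unfolding f_def by (rule the_equality) (use that uniq in blast)+
  obtain e where e: "e \<in> carrier S" "\<And>x. x \<in> sumset A B \<Longrightarrow> e x = f x"
  proof (rule extend_hom[OF submodule_sumset(1)[OF A B], of f])
    show "f x \<in> carrier G" if "x \<in> sumset A B" for x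
      using that f a(1) unfolding sumset_def by auto
    show "f (x \<cdot> r) = f x \<cdot> r" if x: "x \<in> sumset A B" and r: "r \<in> carrier R" for x r
    proof -
      obtain p q where pq: "p \<in> A" "q \<in> B" "x = p \<oplus>\<^bsub>G\<^esub> q" using x unfolding sumset_def by blast
      then have "x \<cdot> r = p \<cdot> r \<oplus>\<^bsub>G\<^esub> q \<cdot> r" using a(1) b(1) r by (simp add: smult_l_distr)
      then show ?thesis using f[OF pq(1,2)] f[OF a(4)[OF pq(1) r] b(4)[OF pq(2) r]] pq(3) by simp
    qed
    show "f (x \<oplus>\<^bsub>G\<^esub> y) = f x \<oplus>\<^bsub>G\<^esub> f y" if x: "x \<in> sumset A B" and y: "y \<in> sumset A B" for x y
    proof -
      obtain p q where pq: "p \<in> A" "q \<in> B" "x = p \<oplus>\<^bsub>G\<^esub> q" using x unfolding sumset_def by blast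
      obtain p' q' where pq': "p' \<in> A" "q' \<in> B" "y = p' \<oplus>\<^bsub>G\<^esub> q'" using y unfolding sumset_def by blast
      have "x \<oplus>\<^bsub>G\<^esub> y = (p \<oplus>\<^bsub>G\<^esub> p') \<oplus>\<^bsub>G\<^esub> (q \<oplus>\<^bsub>G\<^esub> q')"
        using pq pq' a(1) b(1) by (simp add: G.a_ac)
      then show ?thesis
        using f[OF pq(1,2)] f[OF pq'(1,2)] f[OF a(3)[OF pq(1) pq'(1)] b(3)[OF pq(2) pq'(2)]] pq(3) pq'(3)
        by simp
    qed
  qed blast
  show thesis
  proof (rule goal[OF e(1)])
    show "e p = p" if "p \<in> A" for p
      using that e(2)[of p] f[OF that b(2)] a(1)[OF that] submodule_sumset(2)[OF A B] by auto
    show "e q = \<zero>\<^bsub>G\<^esub>" if "q \<in> B" for q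
      using that e(2)[of q] f[OF a(2) that] b(1)[OF that] submodule_sumset(3)[OF A B] by auto
  qed
qed

text \<open>\<open>B\<close> is maximal among the submodules above \<open>A\<close> that meet
  \<open>K\<close> trivially. The last clause is maximality read elementwise: for \<open>v\<close>
  outside \<open>B\<close>, the sum of \<open>B\<close> and the cyclic submodule of \<open>v\<close>
  meets \<open>K\<close> nontrivially.\<close>

lemma maximal_disjoint_submodule:
  assumes A: "submodule R E A" "A \<inter> K \<subseteq> {\<zero>\<^bsub>G\<^esub>}"
  obtains B where "submodule R E B" "A \<subseteq> B" "B \<inter> K \<subseteq> {\<zero>\<^bsub>G\<^esub>}"
    "\<And>v. v \<in> carrier G \<Longrightarrow> v \<notin> B \<Longrightarrow>
      \<exists>b\<in>B. \<exists>r\<in>carrier R. b \<oplus>\<^bsub>G\<^esub> v \<cdot> r \<in> K \<and> b \<oplus>\<^bsub>G\<^esub> v \<cdot> r \<noteq> \<zero>\<^bsub>G\<^esub>"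
proof -
  obtain B where B: "submodule R E B" "A \<subseteq> B \<and> B \<inter> K \<subseteq> {\<zero>\<^bsub>G\<^esub>}"
    and max: "\<And>L'. submodule R E L' \<Longrightarrow> A \<subseteq> L' \<and> L' \<inter> K \<subseteq> {\<zero>\<^bsub>G\<^esub>} \<Longrightarrow> B \<subseteq> L' \<Longrightarrow> L' = B"
  proof (rule maximal_submodule[of A "\<lambda>L. A \<subseteq> L \<and> L \<inter> K \<subseteq> {\<zero>\<^bsub>G\<^esub>}"])
    fix C assume C: "C \<noteq> {}" "\<And>L. L \<in> C \<Longrightarrow> A \<subseteq> L \<and> L \<inter> K \<subseteq> {\<zero>\<^bsub>G\<^esub>}"
    obtain L where "L \<in> C" using C(1) by auto
    then show "A \<subseteq> \<Union>C \<and> \<Union>C \<inter> K \<subseteq> {\<zero>\<^bsub>G\<^esub>}" using C(2) by (auto dest: C(2))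
  qed (use A in auto)
  have "\<exists>b\<in>B. \<exists>r\<in>carrier R. b \<oplus>\<^bsub>G\<^esub> v \<cdot> r \<in> K \<and> b \<oplus>\<^bsub>G\<^esub> v \<cdot> r \<noteq> \<zero>\<^bsub>G\<^esub>"
    if v: "v \<in> carrier G" "v \<notin> B" for v
  proof -
    let ?L = "sumset B (cyclic v)"
    note s = submodule_sumset[OF B(1) submodule_cyclic[OF v(1)]]
    have "?L \<noteq> B" using s(3) cyclic_self v by blast
    then have "\<not> (A \<subseteq> ?L \<and> ?L \<inter> K \<subseteq> {\<zero>\<^bsub>G\<^esub>})" using max[OF s(1)] s(2) by blast
    then obtain w where "w \<in> ?L" "w \<in> K" "w \<noteq> \<zero>\<^bsub>G\<^esub>" using B(2) s(2) by blast
    then show ?thesis unfolding sumset_def cyclic_def by auto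
  qed
  then show thesis using that B by blast
qed

text \<open>Choose \<open>B\<close> above \<open>K0\<close> maximal with trivial intersection with
  \<open>K\<close>, then \<open>C\<close> above \<open>K\<close> maximal with trivial intersection
  with \<open>B\<close>. The two maximalities force any extension of the projection of
  \<open>C + B\<close> onto \<open>C\<close> to have image \<open>C\<close>; this \<open>C\<close>
  is a hull of \<open>K\<close> inside \<open>E\<close>.\<close>

lemma hull_idempotent:
  assumes K: "submodule R E K" and K0: "submodule R E K0" and disj: "K0 \<inter> K \<subseteq> {\<zero>\<^bsub>G\<^esub>}"
  obtains e where "e \<in> carrier S" "e \<otimes>\<^bsub>S\<^esub> e = e" "\<And>x. x \<in> K \<Longrightarrow> e x = x"
    "essential_in K (fixed e)" "\<And>x. x \<in> K0 \<Longrightarrow> e x = \<zero>\<^bsub>G\<^esub>"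
proof -
  obtain B where B: "submodule R E B" "K0 \<subseteq> B" "B \<inter> K \<subseteq> {\<zero>\<^bsub>G\<^esub>}"
    and maxB: "\<And>v. v \<in> carrier G \<Longrightarrow> v \<notin> B \<Longrightarrow>
      \<exists>b\<in>B. \<exists>r\<in>carrier R. b \<oplus>\<^bsub>G\<^esub> v \<cdot> r \<in> K \<and> b \<oplus>\<^bsub>G\<^esub> v \<cdot> r \<noteq> \<zero>\<^bsub>G\<^esub>"
    using maximal_disjoint_submodule[OF K0 disj] by metis
  have "K \<inter> B \<subseteq> {\<zero>\<^bsub>G\<^esub>}" using B(3) by blast
  then obtain C where C: "submodule R E C" "K \<subseteq> C" "C \<inter> B \<subseteq> {\<zero>\<^bsub>G\<^esub>}"
    and maxC: "\<And>v. v \<in> carrier G \<Longrightarrow> v \<notin> C \<Longrightarrow>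
      \<exists>b\<in>C. \<exists>r\<in>carrier R. b \<oplus>\<^bsub>G\<^esub> v \<cdot> r \<in> B \<and> b \<oplus>\<^bsub>G\<^esub> v \<cdot> r \<noteq> \<zero>\<^bsub>G\<^esub>"
    using maximal_disjoint_submodule[OF K] by metis
  note b = submoduleD[OF B(1)] and c = submoduleD[OF C(1)]
  obtain e where e: "e \<in> carrier S" "\<And>a. a \<in> C \<Longrightarrow> e a = a" "\<And>b. b \<in> B \<Longrightarrow> e b = \<zero>\<^bsub>G\<^esub>"
    using projection[OF C(1) B(1) C(3)] by metis
  \<comment> \<open>If \<open>e v\<close> were outside \<open>C\<close>, some nonzero
    \<open>p + e v r\<close> would lie in \<open>B\<close>. It equals \<open>e w\<close> for
    \<open>w = p + v r\<close>, and \<open>w\<close> is outside \<open>B\<close> because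
    \<open>e\<close> kills \<open>B\<close>. So some nonzero \<open>q + w s\<close> lies in
    \<open>K\<close>; \<open>e\<close> fixes it but also maps it to \<open>e w s\<close> in
    \<open>B\<close>, contradicting \<open>B \<inter> K = 0\<close>.\<close>
  have eC: "e v \<in> C" if v: "v \<in> carrier G" for v
  proof (rule ccontr)
    assume "e v \<notin> C"
    then obtain p r where p: "p \<in> C" "r \<in> carrier R" "p \<oplus>\<^bsub>G\<^esub> e v \<cdot> r \<in> B" "p \<oplus>\<^bsub>G\<^esub> e v \<cdot> r \<noteq> \<zero>\<^bsub>G\<^esub>"
      using maxC[OF endo_closed[OF e(1) v]] by blast
    let ?w = "p \<oplus>\<^bsub>G\<^esub> v \<cdot> r"
    have pc: "p \<in> carrier G" using p(1) c(1) by blast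
    have w: "?w \<in> carrier G" using pc v p(2) by simp
    have ew: "e ?w = p \<oplus>\<^bsub>G\<^esub> e v \<cdot> r"
      using e(1) pc v p(1,2) e(2) by (simp add: endo_add endo_smult)
    then have "?w \<notin> B" using e(3)[of ?w] p(4) by auto
    then obtain q s where q: "q \<in> B" "s \<in> carrier R" "q \<oplus>\<^bsub>G\<^esub> ?w \<cdot> s \<in> K" "q \<oplus>\<^bsub>G\<^esub> ?w \<cdot> s \<noteq> \<zero>\<^bsub>G\<^esub>"
      using maxB[OF w] by blast
    have qc: "q \<in> carrier G" using q(1) b(1) by blast
    have "e (q \<oplus>\<^bsub>G\<^esub> ?w \<cdot> s) = e ?w \<cdot> s"
      using e(1) qc w q(2) e(3)[OF q(1)] by (simp add: endo_add endo_smult del: G.add.m_closed)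
    moreover have "e (q \<oplus>\<^bsub>G\<^esub> ?w \<cdot> s) = q \<oplus>\<^bsub>G\<^esub> ?w \<cdot> s" using e(2) q(3) C(2) by blast
    moreover have "e ?w \<cdot> s \<in> B" unfolding ew using p(3) q(2) b(4) by blast
    ultimately show False using q(3,4) B(3) by auto
  qed
  have "fixed e \<subseteq> C" unfolding fixed_def using eC by force
  show thesis
  proof (rule that[OF e(1)])
    show "e \<otimes>\<^bsub>S\<^esub> e = e" using e(1) e(2)[OF eC] by (intro endo_eqI) simp_all
    show "e x = x" if "x \<in> K" for x using that C(2) e(2) by blast
    show "e x = \<zero>\<^bsub>G\<^esub>" if "x \<in> K0" for x using that B(2) e(3) by blast
    \<comment> \<open>Maximality of \<open>B\<close> gives a nonzero \<open>q + v r\<close> in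
      \<open>K\<close> with \<open>q\<close> in \<open>B\<close>. Both \<open>q + v r\<close> and
      \<open>v r\<close> lie in \<open>C\<close>, hence so does \<open>q\<close>, which is therefore
      zero.\<close>
    show "essential_in K (fixed e)"
      unfolding essential_in_def
    proof (intro ballI impI)
      fix v assume "v \<in> fixed e" and v0: "v \<noteq> \<zero>\<^bsub>G\<^esub>"
      then have v: "v \<in> C" using \<open>fixed e \<subseteq> C\<close> by blast
      then have vB: "v \<notin> B" using C(3) v0 by blast
      have vc: "v \<in> carrier G" using v c(1) by blast
      obtain q r where q: "q \<in> B" "r \<in> carrier R" "q \<oplus>\<^bsub>G\<^esub> v \<cdot> r \<in> K" "q \<oplus>\<^bsub>G\<^esub> v \<cdot> r \<noteq> \<zero>\<^bsub>G\<^esub>"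
        using maxB[OF vc vB] by blast
      have qc: "q \<in> carrier G" using q(1) b(1) by blast
      have "q = (q \<oplus>\<^bsub>G\<^esub> v \<cdot> r) \<ominus>\<^bsub>G\<^esub> v \<cdot> r" using qc vc q(2) by (simp add: a_minus_def G.a_assoc G.r_neg)
      moreover have "(q \<oplus>\<^bsub>G\<^esub> v \<cdot> r) \<ominus>\<^bsub>G\<^esub> v \<cdot> r \<in> C" using c(6) c(4)[OF v q(2)] q(3) C(2) by blast
      ultimately have "q = \<zero>\<^bsub>G\<^esub>" using q(1) C(3) by auto
      then show "\<exists>r\<in>carrier R. v \<cdot> r \<in> K \<and> v \<cdot> r \<noteq> \<zero>\<^bsub>G\<^esub>" using q vc by auto
    qed
  qed
qed

section \<open>Maps on direct summands\<close>

lemma submodule_fixed: assumes "e \<in> carrier S" shows "submodule R E (fixed e)"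
  using assms unfolding submodule_iff fixed_def by (auto simp: endo_add endo_smult)

text \<open>For idempotent \<open>e\<close> the fixed points are exactly the image, so
  \<open>fixed e\<close> is the direct summand \<open>e(E)\<close>.\<close>

lemma fixed_idem: "e \<in> carrier S \<Longrightarrow> e \<otimes>\<^bsub>S\<^esub> e = e \<Longrightarrow> x \<in> carrier G \<Longrightarrow> e x \<in> fixed e"
  unfolding fixed_def by (metis (mono_tags, lifting) endo_apply(1) endo_closed mem_Collect_eq)

lemma left_inverse_on_fixed:
  assumes y: "y \<in> carrier S" and h: "h \<in> carrier S" "h \<otimes>\<^bsub>S\<^esub> h = h"
    and inj: "\<And>x. x \<in> fixed h \<Longrightarrow> y x = \<zero>\<^bsub>G\<^esub> \<Longrightarrow> x = \<zero>\<^bsub>G\<^esub>"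
  obtains t where "t \<in> carrier S" "t \<otimes>\<^bsub>S\<^esub> y \<otimes>\<^bsub>S\<^esub> h = h"
proof -
  obtain t where t: "t \<in> carrier S" "\<And>x. x \<in> fixed h \<Longrightarrow> t (y x) = x"
    using extend_inverse[OF y submodule_fixed[OF h(1)] inj] by metis
  have "t \<otimes>\<^bsub>S\<^esub> y \<otimes>\<^bsub>S\<^esub> h = h"
    using t y h fixed_idem[OF h] by (intro endo_eqI) simp_all
  then show thesis using that t by blast
qed

text \<open>A nonzero element of \<open>C\<close> in the kernel of \<open>y\<close> would have a
  nonzero multiple in \<open>K\<close>, again in the kernel.\<close>

lemma inj_on_essential:
  assumes y: "y \<in> carrier S" and C: "C \<subseteq> carrier G" and ess: "essential_in K C"
    and inj: "\<And>x. x \<in> K \<Longrightarrow> y x = \<zero>\<^bsub>G\<^esub> \<Longrightarrow> x = \<zero>\<^bsub>G\<^esub>"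
    and x: "x \<in> C" "y x = \<zero>\<^bsub>G\<^esub>"
  shows "x = \<zero>\<^bsub>G\<^esub>"
proof (rule ccontr)
  assume "x \<noteq> \<zero>\<^bsub>G\<^esub>"
  then obtain r where r: "r \<in> carrier R" "x \<cdot> r \<in> K" "x \<cdot> r \<noteq> \<zero>\<^bsub>G\<^esub>"
    using ess x(1) unfolding essential_in_def by blast
  have "y (x \<cdot> r) = \<zero>\<^bsub>G\<^esub>" using endo_smult[OF y _ r(1)] x C r(1) by auto
  then show False using inj r by blast
qed

text \<open>A left inverse \<open>t\<close> of \<open>y\<close> on \<open>f(E)\<close> comes from
  extending the inverse of \<open>y\<close>. It is injective on \<open>y(f(E))\<close>, hence on
  \<open>f(E)\<close> by essentiality. As \<open>t\<close> kills \<open>y t v - v\<close> for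
  \<open>v\<close> in \<open>f(E)\<close>, it is also a right inverse there.\<close>

lemma iso_on_fixed:
  assumes f: "f \<in> carrier S" "f \<otimes>\<^bsub>S\<^esub> f = f"
    and y: "y \<in> carrier S" "f \<otimes>\<^bsub>S\<^esub> y = y" "y \<otimes>\<^bsub>S\<^esub> f = y"
    and inj: "\<And>x. x \<in> fixed f \<Longrightarrow> y x = \<zero>\<^bsub>G\<^esub> \<Longrightarrow> x = \<zero>\<^bsub>G\<^esub>"
    and ess: "essential_in (y ` fixed f) (fixed f)"
  obtains t where "t \<in> carrier S" "f \<otimes>\<^bsub>S\<^esub> t = t" "t \<otimes>\<^bsub>S\<^esub> f = t" "t \<otimes>\<^bsub>S\<^esub> y = f" "y \<otimes>\<^bsub>S\<^esub> t = f"
proof -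
  obtain t0 where t0: "t0 \<in> carrier S" "t0 \<otimes>\<^bsub>S\<^esub> y \<otimes>\<^bsub>S\<^esub> f = f"
    using left_inverse_on_fixed[OF y(1) f inj] by metis
  \<comment> \<open>Compressing by \<open>f\<close> on both sides places the inverse in the corner
    ring \<open>f S f\<close>.\<close>
  define t where "t = f \<otimes>\<^bsub>S\<^esub> t0 \<otimes>\<^bsub>S\<^esub> f"
  have t: "t \<in> carrier S" using t0 f t_def by simp
  have ft: "f \<otimes>\<^bsub>S\<^esub> t = t" using t0(1) f by (simp add: t_def flip: S.m_assoc)
  have tf: "t \<otimes>\<^bsub>S\<^esub> f = t" using t0(1) f by (simp add: t_def S.m_assoc)
  have "t \<otimes>\<^bsub>S\<^esub> y = f \<otimes>\<^bsub>S\<^esub> (t0 \<otimes>\<^bsub>S\<^esub> y \<otimes>\<^bsub>S\<^esub> f)"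
    unfolding t_def using t0(1) f(1) y by (simp add: S.m_assoc)
  then have ty: "t \<otimes>\<^bsub>S\<^esub> y = f" using t0(2) f by simp
  have on: "y (t v) = v" if v: "v \<in> fixed f" for v
  proof -
    have vc: "v \<in> carrier G" "f v = v" using v unfolding fixed_def by auto
    have app: "f (y x) = y x" "t (y x) = f x" if "x \<in> carrier G" for x
      using endo_apply(1)[OF that, of f y] endo_apply(1)[OF that, of t y] y(2) ty by simp_all
    let ?w = "y (t v) \<ominus>\<^bsub>G\<^esub> v"
    have ytv: "y (t v) \<in> carrier G" "t v \<in> carrier G" using y(1) t vc by simp_all
    have w: "?w \<in> fixed f"
      unfolding fixed_def using ytv vc endo_minus[OF f(1) ytv(1) vc(1)] app(1)[OF ytv(2)] by simp
    have "t ?w = f (t v) \<ominus>\<^bsub>G\<^esub> t v"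
      using endo_minus[OF t ytv(1) vc(1)] app(2)[OF ytv(2)] by simp
    also have "f (t v) = t v" using ft endo_apply(1)[OF vc(1), of f t] by simp
    finally have tw: "t ?w = \<zero>\<^bsub>G\<^esub>" using ytv(2) by (simp add: a_minus_def G.r_neg)
    have "?w = \<zero>\<^bsub>G\<^esub>"
    proof (rule inj_on_essential[OF t _ ess _ w tw])
      show "fixed f \<subseteq> carrier G" by (auto simp: fixed_def)
      fix x assume "x \<in> y ` fixed f" "t x = \<zero>\<^bsub>G\<^esub>"
      then obtain z where z: "z \<in> carrier G" "f z = z" "x = y z" "t (y z) = \<zero>\<^bsub>G\<^esub>" by (auto simp: fixed_def)
      then have "z = \<zero>\<^bsub>G\<^esub>" using app(2) by simp
      then show "x = \<zero>\<^bsub>G\<^esub>" using z(3) y(1) by simp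
    qed
    then show ?thesis using minus_eq_zeroD ytv vc by blast
  qed
  have "y \<otimes>\<^bsub>S\<^esub> t = y \<otimes>\<^bsub>S\<^esub> (t \<otimes>\<^bsub>S\<^esub> f)" unfolding tf ..
  also have "\<dots> = f"
    using y(1) t f on[OF fixed_idem[OF f]] by (intro endo_eqI) simp_all
  finally have "y \<otimes>\<^bsub>S\<^esub> t = f" .
  then show thesis using that t ft tf ty by blast
qed

text \<open>The map \<open>1 - y\<close> is the identity on the essential kernel of
  \<open>y\<close>, hence injective with essential image; \<open>iso_on_fixed\<close> with
  \<open>f = 1\<close> inverts it.\<close>

lemma Units_one_minus_essential_kernel:
  assumes y: "y \<in> carrier S" and ess: "essential_in {x \<in> carrier G. y x = \<zero>\<^bsub>G\<^esub>} (carrier G)"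
  shows "\<one>\<^bsub>S\<^esub> \<ominus>\<^bsub>S\<^esub> y \<in> Units S"
proof -
  let ?z = "\<one>\<^bsub>S\<^esub> \<ominus>\<^bsub>S\<^esub> y" and ?K = "{x \<in> carrier G. y x = \<zero>\<^bsub>G\<^esub>}"
  have z: "?z \<in> carrier S" using y by simp
  have zK: "?z x = x" if "x \<in> ?K" for x using that y by (simp add: a_minus_def)
  have fix1: "fixed \<one>\<^bsub>S\<^esub> = carrier G" by (auto simp: fixed_def)
  obtain t where "t \<in> carrier S" "t \<otimes>\<^bsub>S\<^esub> ?z = \<one>\<^bsub>S\<^esub>" "?z \<otimes>\<^bsub>S\<^esub> t = \<one>\<^bsub>S\<^esub>"
  proof (rule iso_on_fixed[of "\<one>\<^bsub>S\<^esub>" ?z], unfold fix1)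
    show "x = \<zero>\<^bsub>G\<^esub>" if "x \<in> carrier G" "?z x = \<zero>\<^bsub>G\<^esub>" for x
    proof (rule inj_on_essential[OF z _ ess _ that])
      show "u = \<zero>\<^bsub>G\<^esub>" if "u \<in> ?K" "?z u = \<zero>\<^bsub>G\<^esub>" for u using zK that by simp
    qed simp
    show "essential_in (?z ` carrier G) (carrier G)"
      unfolding essential_in_def
    proof (intro ballI impI)
      fix v assume "v \<in> carrier G" "v \<noteq> \<zero>\<^bsub>G\<^esub>"
      then obtain r where r: "r \<in> carrier R" "v \<cdot> r \<in> ?K" "v \<cdot> r \<noteq> \<zero>\<^bsub>G\<^esub>"
        using ess unfolding essential_in_def by blast
      then have "v \<cdot> r \<in> ?z ` carrier G" using zK[OF r(2)] by (metis (no_types, lifting) image_eqI mem_Collect_eq)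
      then show "\<exists>r\<in>carrier R. v \<cdot> r \<in> ?z ` carrier G \<and> v \<cdot> r \<noteq> \<zero>\<^bsub>G\<^esub>" using r by blast
    qed
  qed (use z in auto)
  then show ?thesis using z unfolding Units_def by blast
qed

end

section \<open>The conductor in the endomorphism ring of an injective module\<close>

locale injective_rmod_subring = injective_rmod R E + T: unit_closed_subset "endo_ring R E" T
  for R :: "('r, 'a) ring_scheme" and E :: "('r, 'm, 'b) rmodule_scheme" and T
begin

sublocale I: ideal T.conductor S
  by (rule T.conductor_ideal)

text \<open>The kernel of \<open>a y b\<close> is again essential, so \<open>1 - a y b\<close> is a
  unit and lies in \<open>T\<close>, and therefore so does \<open>a y b\<close>.\<close>

lemma essential_kernel_in_conductor:
  assumes y: "y \<in> carrier S" and ess: "essential_in {x \<in> carrier G. y x = \<zero>\<^bsub>G\<^esub>} (carrier G)"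
  shows "y \<in> T.conductor"
proof (rule T.conductorI[OF y])
  fix a b assume ab: "a \<in> carrier S" "b \<in> carrier S"
  let ?z = "a \<otimes>\<^bsub>S\<^esub> y \<otimes>\<^bsub>S\<^esub> b"
  have z: "?z \<in> carrier S" using ab y by simp
  have app: "?z x = a (y (b x))" if "x \<in> carrier G" for x using that ab by simp
  have "essential_in {x \<in> carrier G. ?z x = \<zero>\<^bsub>G\<^esub>} (carrier G)"
    unfolding essential_in_def
  proof (intro ballI impI)
    fix v assume v: "v \<in> carrier G" "v \<noteq> \<zero>\<^bsub>G\<^esub>"
    show "\<exists>r\<in>carrier R. v \<cdot> r \<in> {x \<in> carrier G. ?z x = \<zero>\<^bsub>G\<^esub>} \<and> v \<cdot> r \<noteq> \<zero>\<^bsub>G\<^esub>"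
    \<comment> \<open>Essentiality pulls back along \<open>b\<close>: either \<open>v\<close> is
      already killed, or a nonzero multiple of \<open>b v\<close> killed by \<open>y\<close> yields
      the required multiple of \<open>v\<close>.\<close>
    proof (cases "b v = \<zero>\<^bsub>G\<^esub>")
      case True
      then have "?z v = \<zero>\<^bsub>G\<^esub>" unfolding app[OF v(1)] using ab y by simp
      then show ?thesis using v by (intro bexI[of _ "\<one>\<^bsub>R\<^esub>"]) auto
    next
      case False
      have "b v \<in> carrier G" using ab v by simp
      then obtain r where r: "r \<in> carrier R" "y (b v \<cdot> r) = \<zero>\<^bsub>G\<^esub>" "b v \<cdot> r \<noteq> \<zero>\<^bsub>G\<^esub>"
        using ess False unfolding essential_in_def by blast
      have bv: "b v \<cdot> r = b (v \<cdot> r)" using endo_smult[OF ab(2) v(1) r(1)] by simp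
      have "?z (v \<cdot> r) = \<zero>\<^bsub>G\<^esub>"
        using app[of "v \<cdot> r"] r ab v bv by simp
      moreover have "v \<cdot> r \<noteq> \<zero>\<^bsub>G\<^esub>" using r(3) bv ab by auto
      ultimately show ?thesis using r(1) v(1) by auto
    qed
  qed
  then have "\<one>\<^bsub>S\<^esub> \<ominus>\<^bsub>S\<^esub> (\<one>\<^bsub>S\<^esub> \<ominus>\<^bsub>S\<^esub> ?z) \<in> T"
    using Units_one_minus_essential_kernel[OF z] T.T_Units T.T_minus S.Units_one_closed by blast
  moreover have "\<one>\<^bsub>S\<^esub> \<ominus>\<^bsub>S\<^esub> (\<one>\<^bsub>S\<^esub> \<ominus>\<^bsub>S\<^esub> ?z) = ?z"
    using z S.one_closed by algebra
  ultimately show "?z \<in> T" by simp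
qed

text \<open>Injectivity of \<open>y\<close> on \<open>K\<close> spreads to the hull
  \<open>h(E)\<close>, so \<open>h = t y h\<close> for some \<open>t\<close>, a multiple of
  \<open>y\<close>.\<close>

lemma hull_idempotent_in_conductor:
  assumes y: "y \<in> T.conductor" and h: "h \<in> carrier S" "h \<otimes>\<^bsub>S\<^esub> h = h"
    and ess: "essential_in K (fixed h)"
    and inj: "\<And>x. x \<in> K \<Longrightarrow> y x = \<zero>\<^bsub>G\<^esub> \<Longrightarrow> x = \<zero>\<^bsub>G\<^esub>"
  shows "h \<in> T.conductor"
proof -
  have yc: "y \<in> carrier S" using y T.conductor_carrier by blast
  have "fixed h \<subseteq> carrier G" by (auto simp: fixed_def)
  then obtain t where t: "t \<in> carrier S" "t \<otimes>\<^bsub>S\<^esub> y \<otimes>\<^bsub>S\<^esub> h = h"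
    using left_inverse_on_fixed[OF yc h] inj_on_essential[OF yc _ ess inj] by metis
  have "t \<otimes>\<^bsub>S\<^esub> y \<otimes>\<^bsub>S\<^esub> h \<in> T.conductor" using I.I_r_closed[OF I.I_l_closed[OF y t(1)] h(1)] .
  then show ?thesis using t(2) by simp
qed

text \<open>
  Take \<open>X\<close> maximal such that \<open>x\<close> is injective on \<open>X\<close> and \<open>X \<inter> x(X) = 0\<close>. The idempotent \<open>e\<close> onto the
  hull of \<open>X\<close> lies in the conductor because \<open>(1 - e) x e\<close> does and is injective on \<open>X\<close>; the same
  follows for the idempotent \<open>h\<close> onto the hull of \<open>X + x(X)\<close>. By maximality, off \<open>h\<close> the map \<open>x\<close> acts
  on every nonzero cyclic submodule as a scalar up to passing to a nonzero multiple, so after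
  splitting off the hull of its kernel it becomes invertible on the remaining summand \<open>f(E)\<close>.
\<close>

lemma unit_idempotent_decomp:
  assumes x: "x \<in> carrier S"
  shows "\<exists>u\<in>Units S. \<exists>f\<in>carrier S. f \<otimes>\<^bsub>S\<^esub> f = f \<and> x \<ominus>\<^bsub>S\<^esub> u \<otimes>\<^bsub>S\<^esub> f \<in> T.conductor"
proof -
  \<comment> \<open>The single condition encodes both demands on \<open>X\<close>. As 0 lies in
    \<open>X\<close>, it gives injectivity of \<open>x\<close> on \<open>X\<close>; it also makes
    \<open>x(X)\<close> meet \<open>X\<close> only in zero.\<close>
  obtain X where X: "submodule R E X" and QX: "\<And>p. p \<in> X \<Longrightarrow> x p \<in> X \<Longrightarrow> p = \<zero>\<^bsub>G\<^esub>"
    and max: "\<And>L. submodule R E L \<Longrightarrow> \<forall>p\<in>L. x p \<in> L \<longrightarrow> p = \<zero>\<^bsub>G\<^esub> \<Longrightarrow> X \<subseteq> L \<Longrightarrow> L = X"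
  proof (rule maximal_submodule[of "{\<zero>\<^bsub>G\<^esub>}" "\<lambda>L. \<forall>p\<in>L. x p \<in> L \<longrightarrow> p = \<zero>\<^bsub>G\<^esub>"])
    show "submodule R E {\<zero>\<^bsub>G\<^esub>}" by (simp add: submodule_iff)
    fix C assume C: "\<And>L L'. L \<in> C \<Longrightarrow> L' \<in> C \<Longrightarrow> L \<subseteq> L' \<or> L' \<subseteq> L"
      "\<And>L. L \<in> C \<Longrightarrow> \<forall>p\<in>L. x p \<in> L \<longrightarrow> p = \<zero>\<^bsub>G\<^esub>"
    show "\<forall>p\<in>\<Union>C. x p \<in> \<Union>C \<longrightarrow> p = \<zero>\<^bsub>G\<^esub>"
    proof (intro ballI impI)
      fix p assume "p \<in> \<Union>C" "x p \<in> \<Union>C"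
      then obtain L L' where L: "L \<in> C" "p \<in> L" "L' \<in> C" "x p \<in> L'" by auto
      then show "p = \<zero>\<^bsub>G\<^esub>" using C(1)[OF L(1,3)] C(2)[OF L(1)] C(2)[OF L(3)] by auto
    qed
  qed auto
  note l = submoduleD[OF X]
  let ?xX = "x ` X"
  have xX: "submodule R E ?xX" by (rule submodule_image[OF x X])
  have "?xX \<inter> X \<subseteq> {\<zero>\<^bsub>G\<^esub>}"
  proof clarify
    fix p assume "p \<in> X" "x p \<in> X"
    then have "p = \<zero>\<^bsub>G\<^esub>" by (rule QX)
    then show "x p = \<zero>\<^bsub>G\<^esub>" using x by simp
  qed
  then obtain e where e: "e \<in> carrier S" "e \<otimes>\<^bsub>S\<^esub> e = e" "\<And>p. p \<in> X \<Longrightarrow> e p = p"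
    "essential_in X (fixed e)" "\<And>q. q \<in> ?xX \<Longrightarrow> e q = \<zero>\<^bsub>G\<^esub>"
    using hull_idempotent[OF X xX] by metis
  define e' where "e' = \<one>\<^bsub>S\<^esub> \<ominus>\<^bsub>S\<^esub> e"
  have e': "e' \<in> carrier S" using e(1) e'_def by simp
  have e'_app: "e' v = v \<ominus>\<^bsub>G\<^esub> e v" if "v \<in> carrier G" for v using that e(1) by (simp add: e'_def)
  have e'X: "e' p = \<zero>\<^bsub>G\<^esub>" if "p \<in> X" for p
    using e'_app[OF l(1)[OF that]] e(3)[OF that] l(1)[OF that] by (simp add: a_minus_def G.r_neg)
  have e'xX: "e' (x p) = x p" if "p \<in> X" for p
    using e'_app[OF endo_closed[OF x l(1)[OF that]]] e(5)[of "x p"] that l(1)[OF that] x by (simp add: a_minus_def)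
  note ic = S.idem_compl[OF e(1,2), folded e'_def]
  have eI: "e \<in> T.conductor"
  proof (rule hull_idempotent_in_conductor[of "e' \<otimes>\<^bsub>S\<^esub> x \<otimes>\<^bsub>S\<^esub> e", OF _ e(1,2,4)])
    show "e' \<otimes>\<^bsub>S\<^esub> x \<otimes>\<^bsub>S\<^esub> e \<in> T.conductor"
      by (rule T.corner_in_conductor) (use e e' x ic in \<open>simp_all add: S.a_comm\<close>)
    show "p = \<zero>\<^bsub>G\<^esub>" if p: "p \<in> X" "(e' \<otimes>\<^bsub>S\<^esub> x \<otimes>\<^bsub>S\<^esub> e) p = \<zero>\<^bsub>G\<^esub>" for p
    proof -
      have "x p = \<zero>\<^bsub>G\<^esub>" using p(2) e'xX[OF p(1)] e(3)[OF p(1)] l(1)[OF p(1)] by simp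
      then show ?thesis using QX[OF p(1)] l(2) by simp
    qed
  qed
  obtain t where t: "t \<in> carrier S" "\<And>p. p \<in> X \<Longrightarrow> t (x p) = p"
    using extend_inverse[OF x X] QX l(2) by metis
  \<comment> \<open>Both summands contain the factor \<open>e\<close>, so \<open>z\<close> lies in
    the conductor. The first summand is the identity on \<open>X\<close> and zero on
    \<open>x(X)\<close>; the second is zero on \<open>X\<close> and the identity on
    \<open>x(X)\<close>, since \<open>t\<close> undoes \<open>x\<close> there.\<close>
  define z where "z = e \<oplus>\<^bsub>S\<^esub> x \<otimes>\<^bsub>S\<^esub> e \<otimes>\<^bsub>S\<^esub> (t \<otimes>\<^bsub>S\<^esub> e')"
  have "t \<otimes>\<^bsub>S\<^esub> e' \<in> carrier S" using t(1) e' by simp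
  then have zI: "z \<in> T.conductor"
    unfolding z_def using I.a_closed[OF eI I.I_r_closed[OF I.I_l_closed[OF eI x]]] by blast
  have zc: "z \<in> carrier S" using zI T.conductor_carrier by blast
  let ?Z = "sumset X ?xX"
  note Z = submodule_sumset[OF X xX]
  have z_id: "z w = w" if w: "w \<in> ?Z" for w
  proof -
    obtain p q where pq: "p \<in> X" "q \<in> X" "w = p \<oplus>\<^bsub>G\<^esub> x q" using w unfolding sumset_def by blast
    have c: "p \<in> carrier G" "q \<in> carrier G" "x q \<in> carrier G" using pq l(1) x by simp_all
    have zp: "z p = p" using c(1) e(3)[OF pq(1)] e'X[OF pq(1)] t(1) e(1) x by (simp add: z_def)
    have "z (x q) = x q"
      using c e(5)[of "x q"] e'xX[OF pq(2)] t(2)[OF pq(2)] e(3)[OF pq(2)] pq(2) by (simp add: z_def)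
    then show ?thesis using zp endo_add[OF zc c(1,3)] pq(3) by simp
  qed
  have "submodule R E {\<zero>\<^bsub>G\<^esub>}" by (simp add: submodule_iff)
  then obtain h where h: "h \<in> carrier S" "h \<otimes>\<^bsub>S\<^esub> h = h" "\<And>p. p \<in> ?Z \<Longrightarrow> h p = p" "essential_in ?Z (fixed h)"
    using hull_idempotent[OF Z(1), of "{\<zero>\<^bsub>G\<^esub>}"] by (metis inf_le1)
  have hI: "h \<in> T.conductor"
    by (rule hull_idempotent_in_conductor[OF zI h(1,2,4)]) (simp add: z_id)
  define h' where "h' = \<one>\<^bsub>S\<^esub> \<ominus>\<^bsub>S\<^esub> h"
  have h': "h' \<in> carrier S" using h(1) h'_def by simp
  note hc = S.idem_compl[OF h(1,2), folded h'_def]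
  have h'_app: "h' v = v \<ominus>\<^bsub>G\<^esub> h v" if "v \<in> carrier G" for v using that h(1) by (simp add: h'_def)
  have h'Z: "h' p = \<zero>\<^bsub>G\<^esub>" if "p \<in> ?Z" for p
    using h'_app h(3)[OF that] submoduleD(1)[OF Z(1) that] by (simp add: a_minus_def G.r_neg)
  have h'_id: "h' v = v" if "v \<in> carrier G" "h v = \<zero>\<^bsub>G\<^esub>" for v
    using h'_app that by (simp add: a_minus_def)
  \<comment> \<open>\<open>x'\<close> is the compression of \<open>x\<close> to
    \<open>h'(E)\<close>, and \<open>K\<close> below is its kernel there.\<close>
  define x' where "x' = h' \<otimes>\<^bsub>S\<^esub> x \<otimes>\<^bsub>S\<^esub> h'"
  have x': "x' \<in> carrier S" using x'_def h' x by simp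
  have x'_app: "x' v = h' (x v)" if "v \<in> carrier G" "h v = \<zero>\<^bsub>G\<^esub>" for v
    using that h'_id[OF that] by (simp add: x'_def)
  define K where "K = {v \<in> carrier G. h v = \<zero>\<^bsub>G\<^esub> \<and> x' v = \<zero>\<^bsub>G\<^esub>}"
  have K: "submodule R E K"
    unfolding submodule_iff K_def using h(1) x' by (auto simp: endo_add endo_smult)
  have "fixed h \<inter> K \<subseteq> {\<zero>\<^bsub>G\<^esub>}" unfolding fixed_def K_def by auto
  then obtain k0 where k0: "k0 \<in> carrier S" "k0 \<otimes>\<^bsub>S\<^esub> k0 = k0" "\<And>p. p \<in> K \<Longrightarrow> k0 p = p"
    "essential_in K (fixed k0)" "\<And>q. q \<in> fixed h \<Longrightarrow> k0 q = \<zero>\<^bsub>G\<^esub>"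
    using hull_idempotent[OF K submodule_fixed[OF h(1)]] by metis
  have k0h: "k0 \<otimes>\<^bsub>S\<^esub> h = \<zero>\<^bsub>S\<^esub>"
    using k0(1,5) h fixed_idem[OF h(1,2)] by (intro endo_eqI) simp_all
  then have k0h': "k0 \<otimes>\<^bsub>S\<^esub> h' = k0"
    using k0(1) h(1) by (simp add: h'_def a_minus_def S.r_distr S.r_minus)
  \<comment> \<open>The image of \<open>k0\<close> need not lie in \<open>h'(E)\<close>. Multiplying
    by \<open>h'\<close> makes the idempotent orthogonal to \<open>h\<close> on both sides, still
    fixes \<open>K\<close>, and keeps \<open>K\<close> essential in the summand.\<close>
  define k where "k = h' \<otimes>\<^bsub>S\<^esub> k0"
  have k: "k \<in> carrier S" using k_def h' k0 by simp
  have kh: "k \<otimes>\<^bsub>S\<^esub> h = \<zero>\<^bsub>S\<^esub>" using k0h k0(1) h(1) h' by (simp add: k_def S.m_assoc)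
  have hk: "h \<otimes>\<^bsub>S\<^esub> k = \<zero>\<^bsub>S\<^esub>" using hc k0(1) h(1) h' by (simp add: k_def flip: S.m_assoc)
  have kk: "k \<otimes>\<^bsub>S\<^esub> k = k"
  proof -
    have "k \<otimes>\<^bsub>S\<^esub> k = h' \<otimes>\<^bsub>S\<^esub> ((k0 \<otimes>\<^bsub>S\<^esub> h') \<otimes>\<^bsub>S\<^esub> k0)" using k0(1) h' by (simp add: k_def S.m_assoc)
    then show ?thesis unfolding k0h' k0(2) k_def .
  qed
  have h'k: "h' \<otimes>\<^bsub>S\<^esub> k = k" using hc h' k0(1) by (simp add: k_def flip: S.m_assoc)
  have kK: "k v = v" if "v \<in> K" for v
    using that k0(3)[OF that] h'_id unfolding K_def k_def by simp
  have essK: "essential_in K (fixed k)"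
    unfolding essential_in_def
  proof (intro ballI impI)
    fix v assume "v \<in> fixed k" and v0: "v \<noteq> \<zero>\<^bsub>G\<^esub>"
    then have v: "v \<in> carrier G" "h' (k0 v) = v" by (auto simp: fixed_def k_def)
    have kv: "k0 v \<in> fixed k0" using fixed_idem[OF k0(1,2) v(1)] .
    have kvc: "k0 v \<in> carrier G" using k0(1) v(1) by simp
    have "k0 v \<noteq> \<zero>\<^bsub>G\<^esub>" using v v0 h' by auto
    then obtain r where r: "r \<in> carrier R" "k0 v \<cdot> r \<in> K" "k0 v \<cdot> r \<noteq> \<zero>\<^bsub>G\<^esub>"
      using k0(4) kv unfolding essential_in_def by blast
    have "h' (k0 v \<cdot> r) = v \<cdot> r" using endo_smult[OF h' kvc r(1)] v(2) by simp
    moreover have "h' (k0 v \<cdot> r) = k0 v \<cdot> r" using r(2) h'_id unfolding K_def by blast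
    ultimately show "\<exists>r\<in>carrier R. v \<cdot> r \<in> K \<and> v \<cdot> r \<noteq> \<zero>\<^bsub>G\<^esub>" using r by auto
  qed
  \<comment> \<open>This gives \<open>1 = h + k + f\<close>. The first two idempotents absorb the
    part of \<open>x\<close> that vanishes modulo the conductor, and \<open>x\<close> becomes
    invertible on \<open>f(E)\<close>.\<close>
  define f where "f = h' \<ominus>\<^bsub>S\<^esub> k"
  have f: "f \<in> carrier S" using f_def h' k by simp
  have fh: "f \<otimes>\<^bsub>S\<^esub> h = \<zero>\<^bsub>S\<^esub>" "h \<otimes>\<^bsub>S\<^esub> f = \<zero>\<^bsub>S\<^esub>"
    using hc h(1) h' k kh hk by (simp_all add: f_def a_minus_def S.l_distr S.r_distr S.l_minus S.r_minus)
  have kh': "k \<otimes>\<^bsub>S\<^esub> h' = k" using kh k h(1) by (simp add: h'_def a_minus_def S.r_distr S.r_minus)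
  have kf: "k \<otimes>\<^bsub>S\<^esub> f = \<zero>\<^bsub>S\<^esub>"
    using kh' kk k h' by (simp add: f_def a_minus_def S.r_distr S.r_minus S.r_neg)
  have h'f: "h' \<otimes>\<^bsub>S\<^esub> f = f"
    using h'k hc h' k by (simp add: f_def a_minus_def S.r_distr S.r_minus)
  have fh': "f \<otimes>\<^bsub>S\<^esub> h' = f"
    using kh' hc h' k by (simp add: f_def a_minus_def S.l_distr S.l_minus)
  have ff: "f \<otimes>\<^bsub>S\<^esub> f = f"
  proof -
    have "f \<otimes>\<^bsub>S\<^esub> f = h' \<otimes>\<^bsub>S\<^esub> f \<ominus>\<^bsub>S\<^esub> k \<otimes>\<^bsub>S\<^esub> f"
      using f h' k by (subst (1) f_def) (simp add: a_minus_def S.l_distr S.l_minus)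
    then show ?thesis using h'f kf f by (simp add: a_minus_def)
  qed
  define y where "y = f \<otimes>\<^bsub>S\<^esub> x \<otimes>\<^bsub>S\<^esub> f"
  have y: "y \<in> carrier S" "f \<otimes>\<^bsub>S\<^esub> y = y" "y \<otimes>\<^bsub>S\<^esub> f = y"
  proof -
    show "y \<in> carrier S" using f x by (simp add: y_def)
    show "f \<otimes>\<^bsub>S\<^esub> y = y" using f x ff by (simp add: y_def flip: S.m_assoc)
    show "y \<otimes>\<^bsub>S\<^esub> f = y" using f x ff by (simp add: y_def S.m_assoc)
  qed
  \<comment> \<open>Adjoining \<open>v\<close> to \<open>X\<close> violates its defining condition,
    giving nonzero \<open>w = p + v s\<close> with \<open>x w = q + v r\<close>. Applying
    \<open>h'\<close>, which kills \<open>X + x(X)\<close>, leaves \<open>x' (v s) = v r\<close>. If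
    \<open>v s = 0\<close>, then \<open>w\<close> violates the condition on \<open>X\<close> itself;
    if \<open>v r = 0\<close>, then \<open>v s\<close> lies in \<open>K\<close>, which
    \<open>k f = 0\<close> excludes.\<close>
  have scalar: "\<exists>s\<in>carrier R. \<exists>r\<in>carrier R. y (v \<cdot> s) = v \<cdot> r \<and> v \<cdot> r \<noteq> \<zero>\<^bsub>G\<^esub>"
    if v: "v \<in> fixed f" "v \<noteq> \<zero>\<^bsub>G\<^esub>" for v
  proof -
    have vc: "v \<in> carrier G" "f v = v" using v by (auto simp: fixed_def)
    have hv: "h v = \<zero>\<^bsub>G\<^esub>" using endo_apply(1)[OF vc(1), of h f] fh(2) vc by simp
    have fs: "f (v \<cdot> r) = v \<cdot> r" "h (v \<cdot> r) = \<zero>\<^bsub>G\<^esub>" "v \<cdot> r \<in> carrier G" if "r \<in> carrier R" for r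
      using that vc hv endo_smult[OF f vc(1) that] endo_smult[OF h(1) vc(1) that] by simp_all
    have vX: "v \<notin> X" using h(3)[of v] Z(2) hv v(2) by auto
    let ?L = "sumset X (cyclic v)"
    note L = submodule_sumset[OF X submodule_cyclic[OF vc(1)]]
    have "?L \<noteq> X" using L(3) cyclic_self[OF vc(1)] vX by blast
    then obtain w where w: "w \<in> ?L" "x w \<in> ?L" "w \<noteq> \<zero>\<^bsub>G\<^esub>" using max[OF L(1) _ L(2)] by blast
    then obtain p s q r where ps: "p \<in> X" "s \<in> carrier R" "w = p \<oplus>\<^bsub>G\<^esub> v \<cdot> s"
      and qr: "q \<in> X" "r \<in> carrier R" "x w = q \<oplus>\<^bsub>G\<^esub> v \<cdot> r" unfolding sumset_def cyclic_def by blast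
    have c: "p \<in> carrier G" "q \<in> carrier G" "x p \<in> carrier G" "x (v \<cdot> s) \<in> carrier G"
      using ps qr l(1) fs x by simp_all
    have zero: "h' p = \<zero>\<^bsub>G\<^esub>" "h' q = \<zero>\<^bsub>G\<^esub>" "h' (x p) = \<zero>\<^bsub>G\<^esub>"
      using h'Z Z(2,3) ps(1) qr(1) by blast+
    have "h' (x w) = x' (v \<cdot> s)"
      unfolding ps(3) using endo_add[OF x c(1) fs(3)[OF ps(2)]] endo_add[OF h' c(3,4)] zero(3)
        x'_app[OF fs(3,2)[OF ps(2)]] h' c(4) by simp
    moreover have "h' (x w) = v \<cdot> r"
      unfolding qr(3) using endo_add[OF h' c(2) fs(3)[OF qr(2)]] zero(2) h'_id[OF fs(3,2)[OF qr(2)]] fs(3)[OF qr(2)]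
      by simp
    ultimately have x'v: "x' (v \<cdot> s) = v \<cdot> r" by simp
    have vs: "v \<cdot> s \<noteq> \<zero>\<^bsub>G\<^esub>"
    proof
      assume s0: "v \<cdot> s = \<zero>\<^bsub>G\<^esub>"
      then have "v \<cdot> r = \<zero>\<^bsub>G\<^esub>" using x'v x' by simp
      then have "w = p" "x w = q" using ps(3) qr(3) s0 c by simp_all
      then show False using QX ps(1) qr(1) w(3) by blast
    qed
    have vr: "v \<cdot> r \<noteq> \<zero>\<^bsub>G\<^esub>"
    proof
      assume "v \<cdot> r = \<zero>\<^bsub>G\<^esub>"
      then have "v \<cdot> s \<in> K" using x'v fs[OF ps(2)] by (simp add: K_def)
      then have "k (f (v \<cdot> s)) = v \<cdot> s" using kK fs(1)[OF ps(2)] by simp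
      then show False using vs kf endo_apply(1)[OF fs(3)[OF ps(2)], of k f] fs(3)[OF ps(2)] by simp
    qed
    have "f (x (v \<cdot> s)) = f (h' (x (v \<cdot> s)))"
      using endo_apply(1)[OF c(4), of f h'] fh' by simp
    also have "\<dots> = f (v \<cdot> r)" using x'_app[OF fs(3,2)[OF ps(2)]] x'v by simp
    finally have "y (v \<cdot> s) = v \<cdot> r" using fs[OF ps(2)] fs[OF qr(2)] by (simp add: y_def)
    then show ?thesis using vr ps(2) qr(2) by blast
  qed
  obtain g where g: "g \<in> carrier S" "f \<otimes>\<^bsub>S\<^esub> g = g" "g \<otimes>\<^bsub>S\<^esub> f = g" "g \<otimes>\<^bsub>S\<^esub> y = f" "y \<otimes>\<^bsub>S\<^esub> g = f"
  proof (rule iso_on_fixed[OF f ff y])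
    show "v = \<zero>\<^bsub>G\<^esub>" if v: "v \<in> fixed f" "y v = \<zero>\<^bsub>G\<^esub>" for v
    proof (rule ccontr)
      assume "v \<noteq> \<zero>\<^bsub>G\<^esub>"
      then obtain s r where sr: "s \<in> carrier R" "y (v \<cdot> s) = v \<cdot> r" "v \<cdot> r \<noteq> \<zero>\<^bsub>G\<^esub>" using scalar v(1) by blast
      moreover have "y (v \<cdot> s) = \<zero>\<^bsub>G\<^esub>" using endo_smult[OF y(1) _ sr(1)] v sr(1) by (simp add: fixed_def)
      ultimately show False by simp
    qed
    show "essential_in (y ` fixed f) (fixed f)"
      unfolding essential_in_def
    proof (intro ballI impI)
      fix v assume v: "v \<in> fixed f" "v \<noteq> \<zero>\<^bsub>G\<^esub>"
      obtain s r where sr: "s \<in> carrier R" "r \<in> carrier R" "y (v \<cdot> s) = v \<cdot> r" "v \<cdot> r \<noteq> \<zero>\<^bsub>G\<^esub>"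
        using scalar[OF v] by blast
      have "v \<cdot> s \<in> fixed f" using submoduleD(4)[OF submodule_fixed[OF f] v(1) sr(1)] .
      then have "v \<cdot> r \<in> y ` fixed f" using sr(3) by (metis imageI)
      then show "\<exists>r\<in>carrier R. v \<cdot> r \<in> y ` fixed f \<and> v \<cdot> r \<noteq> \<zero>\<^bsub>G\<^esub>" using sr by blast
    qed
  qed blast
  define f' where "f' = \<one>\<^bsub>S\<^esub> \<ominus>\<^bsub>S\<^esub> f"
  have f': "f' \<in> carrier S" using f f'_def by simp
  note fc = S.idem_compl[OF f ff, folded f'_def]
  have ann: "a \<otimes>\<^bsub>S\<^esub> f' = \<zero>\<^bsub>S\<^esub>" if "a \<in> carrier S" "a \<otimes>\<^bsub>S\<^esub> f = a" for a
    using that f f' fc by (metis S.m_assoc S.r_null)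
  have ann': "f' \<otimes>\<^bsub>S\<^esub> a = \<zero>\<^bsub>S\<^esub>" if "a \<in> carrier S" "f \<otimes>\<^bsub>S\<^esub> a = a" for a
    using that f f' fc by (metis S.m_assoc S.l_null)
  \<comment> \<open>The inverse \<open>g\<close> of \<open>y\<close> in the corner is completed by
    the identity on the complementary summand, so \<open>g + f'\<close> inverts
    \<open>y + f'\<close>.\<close>
  have u: "y \<oplus>\<^bsub>S\<^esub> f' \<in> Units S"
  proof -
    have "(y \<oplus>\<^bsub>S\<^esub> f') \<otimes>\<^bsub>S\<^esub> (g \<oplus>\<^bsub>S\<^esub> f') = \<one>\<^bsub>S\<^esub>" "(g \<oplus>\<^bsub>S\<^esub> f') \<otimes>\<^bsub>S\<^esub> (y \<oplus>\<^bsub>S\<^esub> f') = \<one>\<^bsub>S\<^esub>"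
      using y(1) g(1) f' f g(4,5) fc ann[OF y(1,3)] ann[OF g(1,3)] ann'[OF y(1,2)] ann'[OF g(1,2)]
      by (simp_all add: S.l_distr S.r_distr)
    moreover have "y \<oplus>\<^bsub>S\<^esub> f' \<in> carrier S" "g \<oplus>\<^bsub>S\<^esub> f' \<in> carrier S" using y g f' by simp_all
    ultimately show ?thesis unfolding Units_def by blast
  qed
  have uf: "(y \<oplus>\<^bsub>S\<^esub> f') \<otimes>\<^bsub>S\<^esub> f = y" using y f f' fc by (simp add: S.l_distr)
  have x'k: "x' \<otimes>\<^bsub>S\<^esub> k \<in> T.conductor"
  proof (rule essential_kernel_in_conductor)
    show "x' \<otimes>\<^bsub>S\<^esub> k \<in> carrier S" using x' k by simp
    show "essential_in {v \<in> carrier G. (x' \<otimes>\<^bsub>S\<^esub> k) v = \<zero>\<^bsub>G\<^esub>} (carrier G)"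
      unfolding essential_in_def
    proof (intro ballI impI)
      fix v assume v: "v \<in> carrier G" "v \<noteq> \<zero>\<^bsub>G\<^esub>"
      show "\<exists>r\<in>carrier R. v \<cdot> r \<in> {v \<in> carrier G. (x' \<otimes>\<^bsub>S\<^esub> k) v = \<zero>\<^bsub>G\<^esub>} \<and> v \<cdot> r \<noteq> \<zero>\<^bsub>G\<^esub>"
      proof (cases "k v = \<zero>\<^bsub>G\<^esub>")
        case True
        then show ?thesis using v x' by (intro bexI[of _ "\<one>\<^bsub>R\<^esub>"]) auto
      next
        case False
        then obtain r where r: "r \<in> carrier R" "k v \<cdot> r \<in> K" "k v \<cdot> r \<noteq> \<zero>\<^bsub>G\<^esub>"
          using essK fixed_idem[OF k kk v(1)] unfolding essential_in_def by blast
        have kr: "k v \<cdot> r = k (v \<cdot> r)" using endo_smult[OF k v(1) r(1)] by simp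
        have "x' (k (v \<cdot> r)) = \<zero>\<^bsub>G\<^esub>" using r(2) kr by (simp add: K_def)
        moreover have "v \<cdot> r \<noteq> \<zero>\<^bsub>G\<^esub>" using r(3) kr k by auto
        ultimately show ?thesis using r(1) v(1) by auto
      qed
    qed
  qed
  \<comment> \<open>The first term contains \<open>h\<close>, and the second has essential kernel
    because \<open>x'\<close> vanishes on \<open>K\<close>; both lie in the conductor.\<close>
  have xk: "x \<otimes>\<^bsub>S\<^esub> k = h \<otimes>\<^bsub>S\<^esub> (x \<otimes>\<^bsub>S\<^esub> k) \<oplus>\<^bsub>S\<^esub> x' \<otimes>\<^bsub>S\<^esub> k"
  proof -
    have "x' \<otimes>\<^bsub>S\<^esub> k = h' \<otimes>\<^bsub>S\<^esub> (x \<otimes>\<^bsub>S\<^esub> k)" using h'k h' x k by (simp add: x'_def S.m_assoc)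
    then have "h \<otimes>\<^bsub>S\<^esub> (x \<otimes>\<^bsub>S\<^esub> k) \<oplus>\<^bsub>S\<^esub> x' \<otimes>\<^bsub>S\<^esub> k = (h \<oplus>\<^bsub>S\<^esub> h') \<otimes>\<^bsub>S\<^esub> (x \<otimes>\<^bsub>S\<^esub> k)"
      using h(1) h' x k by (simp add: S.l_distr)
    then show ?thesis using hc x k by simp
  qed
  have xkI: "x \<otimes>\<^bsub>S\<^esub> k \<in> T.conductor"
    by (subst xk) (intro I.a_closed I.I_r_closed[OF hI] x'k, use x k in simp)
  have cornerI: "f' \<otimes>\<^bsub>S\<^esub> x \<otimes>\<^bsub>S\<^esub> f \<in> T.conductor"
    by (rule T.corner_in_conductor) (use f f' x fc ff in \<open>simp_all add: S.a_comm\<close>)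
  \<comment> \<open>Use \<open>h + k = 1 - f\<close> on the right of \<open>x\<close>, and then
    \<open>x f - f x f = f' x f\<close>.\<close>
  have "x \<ominus>\<^bsub>S\<^esub> y = x \<otimes>\<^bsub>S\<^esub> h \<oplus>\<^bsub>S\<^esub> x \<otimes>\<^bsub>S\<^esub> k \<oplus>\<^bsub>S\<^esub> f' \<otimes>\<^bsub>S\<^esub> x \<otimes>\<^bsub>S\<^esub> f"
  proof -
    have "h \<oplus>\<^bsub>S\<^esub> k = \<one>\<^bsub>S\<^esub> \<ominus>\<^bsub>S\<^esub> f" unfolding f_def h'_def using h(1) k S.one_closed by algebra
    then have "x \<otimes>\<^bsub>S\<^esub> h \<oplus>\<^bsub>S\<^esub> x \<otimes>\<^bsub>S\<^esub> k = x \<ominus>\<^bsub>S\<^esub> x \<otimes>\<^bsub>S\<^esub> f"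
      using x h(1) k f by (simp add: a_minus_def S.r_minus flip: S.r_distr) (simp add: S.r_distr S.r_minus)
    moreover have "f' \<otimes>\<^bsub>S\<^esub> x \<otimes>\<^bsub>S\<^esub> f = x \<otimes>\<^bsub>S\<^esub> f \<ominus>\<^bsub>S\<^esub> y"
      using x f by (simp add: f'_def y_def a_minus_def S.l_distr S.l_minus)
    moreover have "x \<ominus>\<^bsub>S\<^esub> y = (x \<ominus>\<^bsub>S\<^esub> x \<otimes>\<^bsub>S\<^esub> f) \<oplus>\<^bsub>S\<^esub> (x \<otimes>\<^bsub>S\<^esub> f \<ominus>\<^bsub>S\<^esub> y)"
      using x f y(1) by algebra
    ultimately show ?thesis by simp
  qed
  then have "x \<ominus>\<^bsub>S\<^esub> y \<in> T.conductor"
    using I.a_closed[OF I.a_closed[OF I.I_l_closed[OF hI x] xkI] cornerI] by simp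
  then have "x \<ominus>\<^bsub>S\<^esub> (y \<oplus>\<^bsub>S\<^esub> f') \<otimes>\<^bsub>S\<^esub> f \<in> T.conductor" unfolding uf .
  then show ?thesis using u f ff by blast
qed

end

section \<open>Injective hulls\<close>

locale hull_rmod = M: rmod R M + rmod R E
  for R :: "('r, 'a) ring_scheme" and M :: "('r, 'm, 'b) rmodule_scheme"
    and E :: "('r, 'e, 'c) rmodule_scheme" +
  fixes \<iota> :: "'m \<Rightarrow> 'e"
  assumes hull: "injective_hull R M E \<iota>"
begin

sublocale injective_rmod R E
  using hull by unfold_locales (simp add: injective_hull_def)

abbreviation "V \<equiv> mcarrier M"
abbreviation "N \<equiv> \<iota> ` V"

lemma iota_closed: "x \<in> V \<Longrightarrow> \<iota> x \<in> carrier G"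
  and iota_add: "x \<in> V \<Longrightarrow> y \<in> V \<Longrightarrow> \<iota> (madd M x y) = \<iota> x \<oplus>\<^bsub>G\<^esub> \<iota> y"
  and iota_smult: "x \<in> V \<Longrightarrow> r \<in> carrier R \<Longrightarrow> \<iota> (mact M x r) = \<iota> x \<cdot> r"
  using hull by (auto simp: injective_hull_def rhom_def mgroup_simps)

lemma iota_inj: "inj_on \<iota> V"
  using hull by (simp add: injective_hull_def)

lemma N_submodule: "submodule R E N"
  using hull by (simp add: injective_hull_def essential_submodule_def)

lemma V_closed: "x \<in> V \<Longrightarrow> y \<in> V \<Longrightarrow> madd M x y \<in> V" "x \<in> V \<Longrightarrow> r \<in> carrier R \<Longrightarrow> mact M x r \<in> V"
  using M.right_module by (simp_all add: right_module_def)

lemma iota_zero: "\<iota> (mzero M) = \<zero>\<^bsub>G\<^esub>"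
proof -
  have z: "mzero M \<in> V" using M.right_module by (simp add: right_module_def)
  show ?thesis
    using iota_smult[OF z M.R.zero_closed] M.zero_smult[OF M.R.zero_closed] iota_closed[OF z]
    by (simp add: mgroup_simps(2)[of M])
qed

text \<open>Essentiality against all submodules is tested on the cyclic submodule of
  \<open>v\<close>.\<close>

lemma N_essential: "essential_in N (carrier G)"
  unfolding essential_in_def
proof (intro ballI impI)
  fix v assume v: "v \<in> carrier G" "v \<noteq> \<zero>\<^bsub>G\<^esub>"
  have "cyclic v \<noteq> {\<zero>\<^bsub>G\<^esub>}" using cyclic_self[OF v(1)] v(2) by blast
  then have "cyclic v \<inter> N \<noteq> {\<zero>\<^bsub>G\<^esub>}"
    using hull submodule_cyclic[OF v(1)]
    unfolding injective_hull_def essential_submodule_def mgroup_simps by blast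
  moreover have "\<zero>\<^bsub>G\<^esub> \<in> cyclic v \<inter> N"
    using submoduleD(2)[OF submodule_cyclic[OF v(1)]] submoduleD(2)[OF N_submodule] by blast
  ultimately obtain w where "w \<in> cyclic v" "w \<in> N" "w \<noteq> \<zero>\<^bsub>G\<^esub>" by blast
  then show "\<exists>r\<in>carrier R. v \<cdot> r \<in> N \<and> v \<cdot> r \<noteq> \<zero>\<^bsub>G\<^esub>" unfolding cyclic_def by blast
qed

text \<open>Transported along \<open>\<iota>\<close>, the map becomes a homomorphism from a
  submodule of \<open>E\<close> into \<open>E\<close>, which \<open>extend_hom\<close>
  extends.\<close>

lemma extend_from_submodule:
  assumes L: "submodule R M L" and f: "rhom R (M\<lparr>mcarrier := L\<rparr>) M f"
  obtains s where "s \<in> carrier S" "\<And>x. x \<in> L \<Longrightarrow> s (\<iota> x) = \<iota> (f x)"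
proof -
  have LV: "L \<subseteq> V" and Lc: "\<And>x y. x \<in> L \<Longrightarrow> y \<in> L \<Longrightarrow> madd M x y \<in> L"
    "\<And>x r. x \<in> L \<Longrightarrow> r \<in> carrier R \<Longrightarrow> mact M x r \<in> L" and L0: "mzero M \<in> L"
    using L by (auto simp: submodule_def)
  have f: "\<And>x. x \<in> L \<Longrightarrow> f x \<in> V" "\<And>x y. x \<in> L \<Longrightarrow> y \<in> L \<Longrightarrow> f (madd M x y) = madd M (f x) (f y)"
    "\<And>x r. x \<in> L \<Longrightarrow> r \<in> carrier R \<Longrightarrow> f (mact M x r) = mact M (f x) r"
    using f by (auto simp: rhom_def)
  have mem: "\<And>x. x \<in> L \<Longrightarrow> x \<in> V" using LV by blast
  define j where "j = inv_into V \<iota>"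
  have j: "j (\<iota> x) = x" if "x \<in> L" for x using inv_into_f_f[OF iota_inj mem[OF that]] by (simp add: j_def)
  have sub: "submodule R E (\<iota> ` L)"
    unfolding submodule_iff
  proof (intro conjI ballI)
    show "\<iota> ` L \<subseteq> carrier G" using iota_closed mem by blast
    show "\<zero>\<^bsub>G\<^esub> \<in> \<iota> ` L" using L0 iota_zero by (metis imageI)
    show "p \<oplus>\<^bsub>G\<^esub> q \<in> \<iota> ` L" if "p \<in> \<iota> ` L" "q \<in> \<iota> ` L" for p q
      using that Lc(1) mem by (auto simp flip: iota_add)
    show "p \<cdot> r \<in> \<iota> ` L" if "p \<in> \<iota> ` L" "r \<in> carrier R" for p r
      using that Lc(2) mem by (auto simp flip: iota_smult)
  qed
  obtain s where s: "s \<in> carrier S" "\<And>p. p \<in> \<iota> ` L \<Longrightarrow> s p = \<iota> (f (j p))"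
  proof (rule extend_hom[OF sub, of "\<lambda>p. \<iota> (f (j p))"])
    show "\<iota> (f (j p)) \<in> carrier G" if "p \<in> \<iota> ` L" for p
      using that j f(1) iota_closed by auto
    show "\<iota> (f (j (p \<oplus>\<^bsub>G\<^esub> q))) = \<iota> (f (j p)) \<oplus>\<^bsub>G\<^esub> \<iota> (f (j q))" if pq: "p \<in> \<iota> ` L" "q \<in> \<iota> ` L" for p q
    proof -
      obtain x y where xy: "x \<in> L" "y \<in> L" "p = \<iota> x" "q = \<iota> y" using pq by blast
      have "p \<oplus>\<^bsub>G\<^esub> q = \<iota> (madd M x y)" using iota_add xy mem by simp
      then show ?thesis using xy j Lc(1) f(1,2) iota_add by simp
    qed
    show "\<iota> (f (j (p \<cdot> r))) = \<iota> (f (j p)) \<cdot> r" if pr: "p \<in> \<iota> ` L" "r \<in> carrier R" for p r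
    proof -
      obtain x where x: "x \<in> L" "p = \<iota> x" using pr by blast
      have "p \<cdot> r = \<iota> (mact M x r)" using iota_smult x mem pr by simp
      then show ?thesis using x j Lc(2) f(1,3) iota_smult pr by simp
    qed
  qed blast
  show thesis
  proof (rule that[OF s(1)])
    show "s (\<iota> x) = \<iota> (f x)" if "x \<in> L" for x using s(2)[of "\<iota> x"] j[OF that] that by simp
  qed
qed

lemma extend_endo:
  assumes "rhom R M M g"
  obtains s where "s \<in> carrier S" "\<And>x. x \<in> V \<Longrightarrow> s (\<iota> x) = \<iota> (g x)"
proof (rule extend_from_submodule[of V g])
  show "submodule R M V" using M.right_module by (auto simp: submodule_def right_module_def)
  show "rhom R (M\<lparr>mcarrier := V\<rparr>) M g" using assms by (simp add: rhom_def)
qed (use that in blast)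

lemma restrict_endo:
  assumes s: "s \<in> carrier S" and N: "s ` N \<subseteq> N"
  obtains g where "rhom R M M g" "\<And>x. x \<in> V \<Longrightarrow> \<iota> (g x) = s (\<iota> x)"
proof -
  define g where "g x = inv_into V \<iota> (s (\<iota> x))" for x
  have g: "g x \<in> V" "\<iota> (g x) = s (\<iota> x)" if "x \<in> V" for x
  proof -
    have "s (\<iota> x) \<in> N" using N that by blast
    then show "g x \<in> V" "\<iota> (g x) = s (\<iota> x)" unfolding g_def by (rule inv_into_into, rule f_inv_into_f)
  qed
  have eqI: "a = b" if "\<iota> a = \<iota> b" "a \<in> V" "b \<in> V" for a b
    using that iota_inj by (auto dest: inj_onD)
  have "rhom R M M g"
    unfolding rhom_def
  proof (intro conjI ballI)
    fix x assume x: "x \<in> V"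
    show "g x \<in> V" using g x by blast
    show "g (madd M x y) = madd M (g x) (g y)" if y: "y \<in> V" for y
      by (rule eqI) (use x y g V_closed iota_closed in \<open>simp_all add: iota_add endo_add[OF s]\<close>)
    show "g (mact M x r) = mact M (g x) r" if r: "r \<in> carrier R" for r
      by (rule eqI) (use x r g V_closed iota_closed in \<open>simp_all add: iota_smult endo_smult[OF s]\<close>)
  qed
  then show thesis using that g by blast
qed

text \<open>This is the Johnson-Wong characterization. From right to left, a partial map is extended
  to \<open>E\<close> and the extension restricted to \<open>M\<close>. From left to right, the part
  of \<open>s\<close> that maps into \<open>N\<close> is extended within \<open>M\<close>, and
  essentiality of \<open>N\<close> forces the result to agree with \<open>s\<close>.\<close>

lemma quasi_injective_iff: "quasi_injective R M \<longleftrightarrow> (\<forall>s\<in>carrier S. s ` N \<subseteq> N)"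
proof
  assume qi: "quasi_injective R M"
  show "\<forall>s\<in>carrier S. s ` N \<subseteq> N"
  proof
    fix s assume s: "s \<in> carrier S"
    \<comment> \<open>\<open>L\<close> is the largest submodule of \<open>M\<close> on which
      \<open>s\<close> induces a map into \<open>M\<close>.\<close>
    define L where "L = {x \<in> V. s (\<iota> x) \<in> N}"
    define f where "f x = inv_into V \<iota> (s (\<iota> x))" for x
    have f: "f x \<in> V" "\<iota> (f x) = s (\<iota> x)" if "x \<in> L" for x
    proof -
      have "s (\<iota> x) \<in> N" using that by (simp add: L_def)
      then show "f x \<in> V" "\<iota> (f x) = s (\<iota> x)" unfolding f_def by (rule inv_into_into, rule f_inv_into_f)
    qed
    have eqI: "a = b" if "\<iota> a = \<iota> b" "a \<in> V" "b \<in> V" for a b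
      using that iota_inj by (auto dest: inj_onD)
    have L: "submodule R M L"
      unfolding submodule_def
    proof (intro conjI ballI)
      show "L \<subseteq> V" by (auto simp: L_def)
      have z: "mzero M \<in> V" using M.right_module by (simp add: right_module_def)
      then show "mzero M \<in> L" using s iota_zero submoduleD(2)[OF N_submodule] by (simp add: L_def)
      show "madd M x y \<in> L" if "x \<in> L" "y \<in> L" for x y
        using that V_closed submoduleD(3)[OF N_submodule] iota_closed
        by (simp add: L_def iota_add endo_add[OF s])
      show "mact M x r \<in> L" if "x \<in> L" "r \<in> carrier R" for x r
        using that V_closed submoduleD(4)[OF N_submodule] iota_closed
        by (simp add: L_def iota_smult endo_smult[OF s])
    qed
    have LV: "x \<in> V" if "x \<in> L" for x using that by (simp add: L_def)
    have "rhom R (M\<lparr>mcarrier := L\<rparr>) M f"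
      unfolding rhom_def
    proof (intro conjI ballI; simp)
      fix x assume x: "x \<in> L"
      show "f x \<in> V" using f x by blast
      show "f (madd M x y) = madd M (f x) (f y)" if y: "y \<in> L" for y
      proof (rule eqI)
        have xy: "madd M x y \<in> L" using L x y by (simp add: submodule_def)
        show "f (madd M x y) \<in> V" "madd M (f x) (f y) \<in> V" using f xy x y V_closed by auto
        show "\<iota> (f (madd M x y)) = \<iota> (madd M (f x) (f y))"
          using f x y xy LV iota_closed by (simp add: iota_add endo_add[OF s])
      qed
      show "f (mact M x r) = mact M (f x) r" if r: "r \<in> carrier R" for r
      proof (rule eqI)
        have xr: "mact M x r \<in> L" using L x r by (simp add: submodule_def)
        show "f (mact M x r) \<in> V" "mact M (f x) r \<in> V" using f xr x r V_closed by auto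
        show "\<iota> (f (mact M x r)) = \<iota> (mact M (f x) r)"
          using f x r xr LV iota_closed by (simp add: iota_smult endo_smult[OF s])
      qed
    qed
    then obtain g where g: "rhom R M M g" "\<And>x. x \<in> L \<Longrightarrow> g x = f x"
      using qi L unfolding quasi_injective_def by blast
    obtain t where t: "t \<in> carrier S" "\<And>x. x \<in> V \<Longrightarrow> t (\<iota> x) = \<iota> (g x)"
      using extend_endo[OF g(1)] by metis
    have gV: "g x \<in> V" if "x \<in> V" for x using g(1) that by (simp add: rhom_def)
    \<comment> \<open>A nonzero \<open>t v - s v\<close> has a nonzero multiple
      \<open>t (v r) - s (v r)\<close> in \<open>N\<close>. As \<open>t (v r)\<close> is in
      \<open>N\<close>, so is \<open>s (v r)\<close>; hence \<open>v r\<close> comes from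
      \<open>L\<close>, where \<open>t\<close> and \<open>s\<close> agree, a contradiction.\<close>
    have eq: "t v = s v" if v: "v \<in> N" for v
    proof (rule ccontr)
      assume ne: "t v \<noteq> s v"
      have vc: "v \<in> carrier G" using v iota_closed by blast
      have "t v \<ominus>\<^bsub>G\<^esub> s v \<noteq> \<zero>\<^bsub>G\<^esub>" using ne minus_eq_zeroD endo_closed[OF t(1) vc] endo_closed[OF s vc] by blast
      then obtain r where r: "r \<in> carrier R" "(t v \<ominus>\<^bsub>G\<^esub> s v) \<cdot> r \<in> N" "(t v \<ominus>\<^bsub>G\<^esub> s v) \<cdot> r \<noteq> \<zero>\<^bsub>G\<^esub>"
        using N_essential G.minus_closed[OF endo_closed[OF t(1) vc] endo_closed[OF s vc]]
        unfolding essential_in_def by blast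
      have vr: "v \<cdot> r \<in> N" using submoduleD(4)[OF N_submodule v r(1)] .
      have ts: "t \<ominus>\<^bsub>S\<^esub> s \<in> carrier S" using t(1) s by simp
      have c: "v \<cdot> r \<in> carrier G" "t (v \<cdot> r) \<in> carrier G" "s (v \<cdot> r) \<in> carrier G" using vc r(1) s t(1) by simp_all
      have d: "(t v \<ominus>\<^bsub>G\<^esub> s v) \<cdot> r = t (v \<cdot> r) \<ominus>\<^bsub>G\<^esub> s (v \<cdot> r)"
        using endo_smult[OF ts vc r(1)] s t(1) vc c(1) by simp
      obtain x where x: "x \<in> V" "v \<cdot> r = \<iota> x" using vr by blast
      have tN: "t (v \<cdot> r) \<in> N" using t(2) x gV by simp
      have "s (v \<cdot> r) = t (v \<cdot> r) \<ominus>\<^bsub>G\<^esub> (t (v \<cdot> r) \<ominus>\<^bsub>G\<^esub> s (v \<cdot> r))"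
        using c by (simp add: a_minus_def G.minus_add G.r_neg2)
      moreover have "\<dots> \<in> N" using submoduleD(6)[OF N_submodule tN] r(2) d by simp
      ultimately have "s (\<iota> x) \<in> N" using x by simp
      then have "x \<in> L" using x by (simp add: L_def)
      then have "t (v \<cdot> r) = s (v \<cdot> r)" using t(2)[OF x(1)] g(2) f(2) x by simp
      then show False using r(3) d c by (simp add: a_minus_def G.r_neg)
    qed
    show "s ` N \<subseteq> N"
    proof clarify
      fix x assume x: "x \<in> V"
      have "s (\<iota> x) = \<iota> (g x)" using eq[of "\<iota> x"] t(2)[OF x] x by simp
      then show "s (\<iota> x) \<in> N" using gV[OF x] by simp
    qed
  qed
next
  assume all: "\<forall>s\<in>carrier S. s ` N \<subseteq> N"
  show "quasi_injective R M"
    unfolding quasi_injective_def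
  proof (intro allI impI)
    fix L f assume A: "submodule R M L \<and> rhom R (M\<lparr>mcarrier := L\<rparr>) M f"
    then have LV: "L \<subseteq> V" and fV: "\<And>x. x \<in> L \<Longrightarrow> f x \<in> V" by (auto simp: submodule_def rhom_def)
    obtain s where s: "s \<in> carrier S" "\<And>x. x \<in> L \<Longrightarrow> s (\<iota> x) = \<iota> (f x)"
      using extend_from_submodule A by metis
    obtain g where g: "rhom R M M g" "\<And>x. x \<in> V \<Longrightarrow> \<iota> (g x) = s (\<iota> x)"
      using restrict_endo[OF s(1)] all s(1) by metis
    have "g x = f x" if x: "x \<in> L" for x
    proof (rule inj_onD[OF iota_inj])
      show "\<iota> (g x) = \<iota> (f x)" using g(2) s(2) x LV by auto
      show "g x \<in> V" "f x \<in> V" using g(1) fV x LV by (auto simp: rhom_def)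
    qed
    then show "\<exists>g. rhom R M M g \<and> (\<forall>x\<in>L. g x = f x)" using g(1) by blast
  qed
qed

section \<open>Automorphisms of the hull, and descent to endomorphisms of the module\<close>

lemma restrict_endo_in_S:
  assumes "rhom R E E \<sigma>" shows "restrict \<sigma> (carrier G) \<in> carrier S"
  using assms M.right_module by (intro endoI) (auto simp: rhom_def mgroup_simps(1,3)[symmetric])

lemma rautomorphism_Units:
  assumes "u \<in> Units S" shows "rautomorphism R E u"
proof -
  define w where "w = inv\<^bsub>S\<^esub> u"
  have u: "u \<in> carrier S" "w \<in> carrier S" "w \<otimes>\<^bsub>S\<^esub> u = \<one>\<^bsub>S\<^esub>" "u \<otimes>\<^bsub>S\<^esub> w = \<one>\<^bsub>S\<^esub>"
    using assms by (auto simp: w_def)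
  have "w (u x) = x" "u (w x) = x" if "x \<in> carrier G" for x
    using endo_apply(1)[OF that, of w u] endo_apply(1)[OF that, of u w] u that by simp_all
  then have "bij_betw u (carrier G) (carrier G)"
    using u(1,2) by (intro bij_betwI[of _ _ _ w]) auto
  then show ?thesis using u(1) by (simp add: rautomorphism_def endo_ring_def mgroup_simps)
qed

text \<open>An endomorphism of \<open>M\<close> is evaluated by \<open>\<psi>\<close> on any
  extension to \<open>E\<close>. Two extensions differ by a map that vanishes on the essential
  submodule \<open>N\<close>, and \<open>\<psi>\<close> kills that difference, so the choice is
  immaterial. Sums and composites of extensions extend sums and composites.\<close>

lemma End_has_F2_factor_if:
  assumes \<psi>: "F2_hom S \<psi>"
    and J: "\<And>y. y \<in> carrier S \<Longrightarrow> essential_in {x \<in> carrier G. y x = \<zero>\<^bsub>G\<^esub>} (carrier G) \<Longrightarrow> \<not> \<psi> y"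
  shows "End_has_F2_factor R M"
proof -
  let ?lift = "\<lambda>g s. s \<in> carrier S \<and> (\<forall>x\<in>V. s (\<iota> x) = \<iota> (g x))"
  define \<phi> where "\<phi> g = \<psi> (SOME s. ?lift g s)" for g
  have \<phi>: "\<phi> g = \<psi> s" if s: "?lift g s" for g s
  proof -
    define t where "t = (SOME s. ?lift g s)"
    have t: "?lift g t" unfolding t_def by (rule someI[of "?lift g", OF s])
    have st: "s \<ominus>\<^bsub>S\<^esub> t \<in> carrier S" using s t by simp
    have ker: "(s \<ominus>\<^bsub>S\<^esub> t) v = \<zero>\<^bsub>G\<^esub>" "v \<in> carrier G" if v: "v \<in> N" for v
    proof -
      obtain x where x: "x \<in> V" "v = \<iota> x" using v by blast
      then show "v \<in> carrier G" using iota_closed by blast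
      then show "(s \<ominus>\<^bsub>S\<^esub> t) v = \<zero>\<^bsub>G\<^esub>"
        using s t x endo_closed[of s v] by (simp add: a_minus_def G.r_neg)
    qed
    have "essential_in {x \<in> carrier G. (s \<ominus>\<^bsub>S\<^esub> t) x = \<zero>\<^bsub>G\<^esub>} (carrier G)"
      using N_essential ker unfolding essential_in_def by blast
    then have "\<not> \<psi> (s \<ominus>\<^bsub>S\<^esub> t)" by (rule J[OF st])
    moreover have "s = (s \<ominus>\<^bsub>S\<^esub> t) \<oplus>\<^bsub>S\<^esub> t" using s t by (simp add: a_minus_def S.a_assoc S.l_neg)
    then have "\<psi> s = (\<psi> (s \<ominus>\<^bsub>S\<^esub> t) \<noteq> \<psi> t)"
      using \<psi> st t unfolding F2_hom_def by metis
    ultimately show ?thesis unfolding \<phi>_def t_def by simp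
  qed
  have ex: "\<exists>s. ?lift g s" if g: "rhom R M M g" for g
    using extend_endo[OF g] by metis
  have closed: "h x \<in> V" if "rhom R M M h" "x \<in> V" for h x using that by (simp add: rhom_def)
  have "\<phi> g = \<phi> h" if gh: "rhom R M M g" "\<forall>x\<in>V. g x = h x" for g h
  proof -
    obtain s where s: "?lift g s" using ex[OF gh(1)] by blast
    then have "?lift h s" using gh(2) by simp
    then show ?thesis using \<phi> s by metis
  qed
  moreover have "\<phi> id"
  proof -
    have "?lift id \<one>\<^bsub>S\<^esub>" using iota_closed by simp
    then show ?thesis using \<phi>[where g = id and s = "\<one>\<^bsub>S\<^esub>"] \<psi> by (simp add: F2_hom_def)
  qed
  moreover have "\<phi> (\<lambda>x. madd M (g x) (h x)) = (\<phi> g \<noteq> \<phi> h)" "\<phi> (g \<circ> h) = (\<phi> g \<and> \<phi> h)"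
    if gh: "rhom R M M g" "rhom R M M h" for g h
  proof -
    obtain s where s: "?lift g s" using ex[OF gh(1)] by blast
    obtain t where t: "?lift h t" using ex[OF gh(2)] by blast
    have add: "?lift (\<lambda>x. madd M (g x) (h x)) (s \<oplus>\<^bsub>S\<^esub> t)"
      using s t closed[OF gh(1)] closed[OF gh(2)] iota_closed by (simp add: iota_add)
    have comp: "?lift (g \<circ> h) (s \<otimes>\<^bsub>S\<^esub> t)"
      using s t closed[OF gh(2)] iota_closed by simp
    show "\<phi> (\<lambda>x. madd M (g x) (h x)) = (\<phi> g \<noteq> \<phi> h)" "\<phi> (g \<circ> h) = (\<phi> g \<and> \<phi> h)"
      unfolding \<phi>[OF add] \<phi>[OF comp] \<phi>[OF s] \<phi>[OF t]
      using \<psi> s t by (simp_all add: F2_hom_def)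
  qed
  ultimately show ?thesis unfolding End_has_F2_factor_def by (intro exI[of _ \<phi>] conjI allI impI) simp_all
qed

theorem quasi_injective_iff_automorphism_invariant:
  assumes noF2: "\<not> End_has_F2_factor R M"
  shows "quasi_injective R M \<longleftrightarrow> automorphism_invariant R M E \<iota>"
proof
  assume "quasi_injective R M"
  then have all: "s ` N \<subseteq> N" if "s \<in> carrier S" for s using quasi_injective_iff that by blast
  show "automorphism_invariant R M E \<iota>"
    unfolding automorphism_invariant_def
  proof (intro allI impI)
    fix \<sigma> assume "rautomorphism R E \<sigma>"
    \<comment> \<open>An automorphism may take any values off the carrier, so it is first cut down
      to its representative in \<open>S\<close>.\<close>
    then have "restrict \<sigma> (carrier G) ` N \<subseteq> N"
      by (intro all restrict_endo_in_S) (simp add: rautomorphism_def)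
    moreover have "restrict \<sigma> (carrier G) ` N = \<sigma> ` N"
      using iota_closed by (intro image_cong) auto
    ultimately show "\<sigma> ` N \<subseteq> N" by (rule back_subst[where P = "\<lambda>A. A \<subseteq> N"])
  qed
next
  assume ai: "automorphism_invariant R M E \<iota>"
  let ?T = "{s \<in> carrier S. s ` N \<subseteq> N}"
  have Nc: "v \<in> carrier G" if "v \<in> N" for v using that iota_closed by blast
  have "unit_closed_subset S ?T"
  proof
    show "s \<oplus>\<^bsub>S\<^esub> t \<in> ?T" if "s \<in> ?T" "t \<in> ?T" for s t
    proof -
      have "(s \<oplus>\<^bsub>S\<^esub> t) v \<in> N" if v: "v \<in> N" for v
      proof -
        have "s v \<in> N" "t v \<in> N" using \<open>s \<in> ?T\<close> \<open>t \<in> ?T\<close> v by blast+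
        then show ?thesis using submoduleD(3)[OF N_submodule] Nc[OF v] by simp
      qed
      then show ?thesis using that by auto
    qed
    show "s \<otimes>\<^bsub>S\<^esub> t \<in> ?T" if "s \<in> ?T" "t \<in> ?T" for s t
    proof -
      have "(s \<otimes>\<^bsub>S\<^esub> t) v \<in> N" if v: "v \<in> N" for v
      proof -
        have "t v \<in> N" using \<open>t \<in> ?T\<close> v by blast
        then have "s (t v) \<in> N" using \<open>s \<in> ?T\<close> by blast
        then show ?thesis using Nc[OF v] by simp
      qed
      then show ?thesis using that by auto
    qed
    show "Units S \<subseteq> ?T"
    proof
      fix u assume u: "u \<in> Units S"
      then have "u ` N \<subseteq> N" using ai rautomorphism_Units unfolding automorphism_invariant_def by blast
      then show "u \<in> ?T" using u by blast
    qed
  qed blast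
  then interpret T: injective_rmod_subring R E ?T
    by (intro injective_rmod_subring.intro injective_rmod_axioms)
  have "?T = carrier S"
  proof (rule ccontr)
    assume "?T \<noteq> carrier S"
    \<comment> \<open>The homomorphism vanishes on the conductor, hence on all endomorphisms with
      essential kernel, which is the condition for its descent to \<open>End(M)\<close>.\<close>
    then obtain \<psi> where "F2_hom S \<psi>" "\<forall>y\<in>T.T.conductor. \<not> \<psi> y"
      using T.T.F2_hom_if_decomp[OF T.unit_idempotent_decomp] by blast
    then have "End_has_F2_factor R M"
      using End_has_F2_factor_if T.essential_kernel_in_conductor by blast
    then show False using noF2 by blast
  qed
  then show "quasi_injective R M" using quasi_injective_iff by blast
qed

end

theorem theorem3:
  fixes R :: "('r, 'a) ring_scheme"
    and M :: "('r, 'm, 'b) rmodule_scheme"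
    and E :: "('r, 'e, 'c) rmodule_scheme"
    and \<iota> :: "'m \<Rightarrow> 'e"
  assumes "ring R"
    and "right_module R M"
    and "injective_hull R M E \<iota>"
    and "\<not> End_has_F2_factor R M"
  shows "quasi_injective R M \<longleftrightarrow> automorphism_invariant R M E \<iota>"
proof -
  interpret hull_rmod R M E \<iota>
    using assms by unfold_locales (simp_all add: injective_hull_def)
  show ?thesis using assms(4) by (rule quasi_injective_iff_automorphism_invariant)
qed

end
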